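(* Let $G$ be a $2$-connected cubic graph with a Kotzig-frame $F$ which has at most two K-components. Then $G$ has a $6$-cycle double cover.
   Context: All graphs are finite and loopless; parallel edges are allowed. A cycle is a connected $2$-regular graph (two parallel edges form a cycle). A cycle double cover (CDC) of $G$ is a set $S$ of cycles of $G$ such that every edge of $G$ lies in precisely two cycles of $S$. For a cubic graph, a $k$-cycle double cover ($k$-CDC) is a CDC that can be partitioned into $k$ (possibly empty) subsets, each consisting of pairwise edge-disjoint cycles. A Kotzig graph is a cubic graph admitting a proper $3$-edge-coloring in which each cycle whose edges carry at most two colors is hamiltonian. A subdivision of a graph $K$ is obtained from $K$ by replacing at least one edge $e=vw$ by a $vw$-path of length at least $2$. Let $G$ be a $2$-connected cubic graph. A Kotzig-frame of $G$ is a spanning subgraph $F$ of $G$ such that (i) every component of $F$ has an even number of vertices, and (ii) every component of $F$ is either a cycle (a C-component) or a subdivision of a Kotzig graph (a K-component). *)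

theory Defs
  imports Main "HOL-Library.Disjoint_Sets"
begin

text \<open>Finite loopless multigraphs: every edge has a set of exactly two ends, and different
  edges may have the same ends.\<close>

record ('v, 'e) mgraph =
  verts :: "'v set"
  edges :: "'e set"
  ends :: "'e \<Rightarrow> 'v set"

definition multigraph :: "('v, 'e) mgraph \<Rightarrow> bool" where
  "multigraph G \<longleftrightarrow> finite (verts G) \<and> finite (edges G) \<and>
     (\<forall>e\<in>edges G. ends G e \<subseteq> verts G \<and> card (ends G e) = 2)"

text \<open>The functions \<open>ends H\<close> and \<open>ends G\<close> must agree everywhere, not just on \<open>edges H\<close>, so that
  a subgraph of \<open>G\<close> is determined by its vertices and edges; subgraphs can then be counted and
  collected in sets.\<close>

definition subgraph :: "('v, 'e) mgraph \<Rightarrow> ('v, 'e) mgraph \<Rightarrow> bool" where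
  "subgraph H G \<longleftrightarrow> multigraph H \<and> verts H \<subseteq> verts G \<and> edges H \<subseteq> edges G \<and> ends H = ends G"

definition spanning_subgraph :: "('v, 'e) mgraph \<Rightarrow> ('v, 'e) mgraph \<Rightarrow> bool" where
  "spanning_subgraph H G \<longleftrightarrow> subgraph H G \<and> verts H = verts G"

definition degree :: "('v, 'e) mgraph \<Rightarrow> 'v \<Rightarrow> nat" where
  "degree G v = card {e \<in> edges G. v \<in> ends G e}"

definition regular :: "nat \<Rightarrow> ('v, 'e) mgraph \<Rightarrow> bool" where
  "regular d G \<longleftrightarrow> (\<forall>v\<in>verts G. degree G v = d)"

definition cubic :: "('v, 'e) mgraph \<Rightarrow> bool" where
  "cubic G \<longleftrightarrow> multigraph G \<and> regular 3 G"

definition adjacency :: "('v, 'e) mgraph \<Rightarrow> ('v \<times> 'v) set" where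
  "adjacency G = {(u, v). \<exists>e\<in>edges G. ends G e = {u, v}}"

definition connected :: "('v, 'e) mgraph \<Rightarrow> bool" where
  "connected G \<longleftrightarrow> verts G \<noteq> {} \<and>
     (\<forall>u\<in>verts G. \<forall>v\<in>verts G. (u, v) \<in> (adjacency G)\<^sup>*)"

definition delete_vertex :: "('v, 'e) mgraph \<Rightarrow> 'v \<Rightarrow> ('v, 'e) mgraph" where
  "delete_vertex G v =
     G\<lparr>verts := verts G - {v}, edges := {e \<in> edges G. v \<notin> ends G e}\<rparr>"

text \<open>Two vertices suffice here, so that the cubic graph consisting of two vertices and three
  parallel edges is 2-connected. (The definition also admits a single edge with its two ends,
  which is not cubic.)\<close>

definition two_connected :: "('v, 'e) mgraph \<Rightarrow> bool" where
  "two_connected G \<longleftrightarrow> multigraph G \<and> card (verts G) \<ge> 2 \<and> connected G \<and>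
     (\<forall>v\<in>verts G. connected (delete_vertex G v))"

definition component :: "('v, 'e) mgraph \<Rightarrow> ('v, 'e) mgraph \<Rightarrow> bool" where
  "component C G \<longleftrightarrow> subgraph C G \<and> connected C \<and>
     (\<forall>D. subgraph D G \<and> connected D \<and> subgraph C D \<longrightarrow> D = C)"

definition cycle :: "('v, 'e) mgraph \<Rightarrow> bool" where
  "cycle C \<longleftrightarrow> multigraph C \<and> connected C \<and> regular 2 C"

definition cycle_of :: "('v, 'e) mgraph \<Rightarrow> ('v, 'e) mgraph \<Rightarrow> bool" where
  "cycle_of C G \<longleftrightarrow> subgraph C G \<and> cycle C"

definition hamiltonian_cycle_of :: "('v, 'e) mgraph \<Rightarrow> ('v, 'e) mgraph \<Rightarrow> bool" where
  "hamiltonian_cycle_of C G \<longleftrightarrow> cycle_of C G \<and> verts C = verts G"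

definition proper_edge_coloring :: "nat \<Rightarrow> ('v, 'e) mgraph \<Rightarrow> ('e \<Rightarrow> nat) \<Rightarrow> bool" where
  "proper_edge_coloring k G c \<longleftrightarrow> (\<forall>e\<in>edges G. c e < k) \<and>
     (\<forall>e\<in>edges G. \<forall>f\<in>edges G. e \<noteq> f \<and> ends G e \<inter> ends G f \<noteq> {} \<longrightarrow> c e \<noteq> c f)"

definition kotzig_graph :: "('v, 'e) mgraph \<Rightarrow> bool" where
  "kotzig_graph K \<longleftrightarrow> cubic K \<and>
     (\<exists>c. proper_edge_coloring 3 K c \<and>
       (\<forall>C. cycle_of C K \<and> card (c ` edges C) \<le> 2 \<longrightarrow> hamiltonian_cycle_of C K))"

text \<open>A path is given by its sequence of vertices and its sequence of edges; its length is the
  number of edges.\<close>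

definition path_in :: "('v, 'e) mgraph \<Rightarrow> 'v list \<Rightarrow> 'e list \<Rightarrow> bool" where
  "path_in G vs es \<longleftrightarrow> set vs \<subseteq> verts G \<and> set es \<subseteq> edges G \<and> distinct vs \<and>
     length vs = Suc (length es) \<and>
     (\<forall>i<length es. ends G (es ! i) = {vs ! i, vs ! Suc i})"

text \<open>\<open>H\<close> arises from \<open>K\<close> by replacing every edge \<open>f\<close> of \<open>K\<close> by the path \<open>(P f, Q f)\<close> with the
  same ends; a path of length 1 means that \<open>f\<close> is kept, up to the name of the edge. The paths are
  internally disjoint from each other and from \<open>verts K\<close>, and at least one of them is longer
  than 1.\<close>

definition subdivision :: "('v, 'e) mgraph \<Rightarrow> ('v, 'f) mgraph \<Rightarrow> bool" where
  "subdivision H K \<longleftrightarrow> multigraph H \<and> multigraph K \<and>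
     (\<exists>P Q.
        (\<forall>f\<in>edges K. path_in H (P f) (Q f) \<and> ends K f = {hd (P f), last (P f)} \<and>
           (set (P f) - ends K f) \<inter> verts K = {}) \<and>
        (\<forall>f\<in>edges K. \<forall>g\<in>edges K. f \<noteq> g \<longrightarrow>
           (set (P f) - ends K f) \<inter> (set (P g) - ends K g) = {} \<and>
           set (Q f) \<inter> set (Q g) = {}) \<and>
        verts H = verts K \<union> (\<Union>f\<in>edges K. set (P f)) \<and>
        edges H = (\<Union>f\<in>edges K. set (Q f)) \<and>
        (\<exists>f\<in>edges K. length (Q f) \<ge> 2))"

text \<open>The edge type of \<open>K\<close> can be taken to be that of \<open>H\<close> without loss of generality: an edge of
  \<open>K\<close> can be named after any edge of the path replacing it.\<close>

definition kotzig_subdivision :: "('v, 'e) mgraph \<Rightarrow> bool" where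
  "kotzig_subdivision H \<longleftrightarrow> (\<exists>K :: ('v, 'e) mgraph. kotzig_graph K \<and> subdivision H K)"

definition C_component :: "('v, 'e) mgraph \<Rightarrow> ('v, 'e) mgraph \<Rightarrow> bool" where
  "C_component C F \<longleftrightarrow> component C F \<and> cycle C"

definition K_component :: "('v, 'e) mgraph \<Rightarrow> ('v, 'e) mgraph \<Rightarrow> bool" where
  "K_component C F \<longleftrightarrow> component C F \<and> kotzig_subdivision C"

definition kotzig_frame :: "('v, 'e) mgraph \<Rightarrow> ('v, 'e) mgraph \<Rightarrow> bool" where
  "kotzig_frame F G \<longleftrightarrow> spanning_subgraph F G \<and>
     (\<forall>C. component C F \<longrightarrow> even (card (verts C)) \<and> (C_component C F \<or> K_component C F))"

definition cycle_double_cover :: "('v, 'e) mgraph set \<Rightarrow> ('v, 'e) mgraph \<Rightarrow> bool" where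
  "cycle_double_cover S G \<longleftrightarrow> (\<forall>C\<in>S. cycle_of C G) \<and>
     (\<forall>e\<in>edges G. card {C \<in> S. e \<in> edges C} = 2)"

definition k_cycle_double_cover :: "nat \<Rightarrow> ('v, 'e) mgraph set \<Rightarrow> ('v, 'e) mgraph \<Rightarrow> bool" where
  "k_cycle_double_cover k S G \<longleftrightarrow> cycle_double_cover S G \<and>
     (\<exists>\<P> :: nat \<Rightarrow> ('v, 'e) mgraph set.
        S = (\<Union>i<k. \<P> i) \<and> disjoint_family_on \<P> {..<k} \<and>
        (\<forall>i<k. pairwise (\<lambda>C D. edges C \<inter> edges D = {}) (\<P> i)))"

end

theory Submission
  imports Defs
begin

text \<open>
  Let \<open>M\<close> be the set of edges of \<open>G\<close> outside the frame. Since every vertex has degree 2 or 3 in the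
  frame, \<open>M\<close> is a matching. Colour each K-component with the three colours of its Kotzig graph, so
  that any two colours together form a cycle through all its vertices of degree 3. Give every edge
  of \<open>M\<close> one of three types, and for a type \<open>t\<close> let \<open>R t\<close> consist of the edges of the K-components
  whose colour is not \<open>t\<close>, together with some C-components. This is an even set. If \<open>R t\<close> contains a
  \<open>T\<close>-join \<open>J\<close> for the set \<open>T\<close> of ends of the \<open>M\<close>-edges of type \<open>t\<close>, then these \<open>M\<close>-edges form even
  sets both with \<open>J\<close> and with \<open>R t - J\<close>. If every frame edge lies in \<open>R t\<close> for exactly two of the
  types \<open>t\<close>, the six even sets so obtained cover every edge twice (\<open>six_even_sets\<close>). Decomposed into
  cycles, they form a 6-cycle double cover, since in a cubic graph no cycle is obtained twice
  (\<open>even_sets_double_cover\<close>).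

  So types are needed such that every component of \<open>R t\<close> contains an even number of ends of edges
  of type \<open>t\<close>. Let a piece be a component of the graph formed by \<open>M\<close> and the C-components.
  The vertices of degree 2 of the K-components are the leaves of the pieces, called attachments; an
  attachment on an edge of colour \<open>i\<close> must receive a type other than \<open>i\<close>. In each piece one type is
  omitted, and the C-components of the piece are put into \<open>R t\<close> for the other two types \<open>t\<close>. Types of the
  attachments that occur evenly often in each piece extend to all \<open>M\<close>-edges, because a \<open>T\<close>-join of
  the piece separates its two types (\<open>edge_types\<close>).

  It remains to make each type occur evenly often at each K-component. A piece with an even number
  of attachments at both K-components can be typed so that it contributes evenly
  (\<open>even_piece_types\<close>). In every other piece both numbers are odd, by handshaking
  (\<open>piece_parity\<close>); there are a colour \<open>i\<close> that is odd at the first K-component and a colour \<open>j\<close> that is odd at the second, and the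
  piece can be typed so that only one type has odd contributions, which can be any type
  other than \<open>i\<close> and \<open>j\<close> (\<open>odd_piece_types\<close>). As the number of these odd pieces is even, a suitable
  permutation of the colours of the second K-component allows all odd contributions to cancel
  (\<open>balanced_types\<close>). A missing K-component is represented by the empty set of vertices.
\<close>

section \<open>Connectivity classes and T-joins\<close>

definition deg :: "('e \<Rightarrow> 'v set) \<Rightarrow> 'e set \<Rightarrow> 'v \<Rightarrow> nat" where
  "deg en E v = card {e \<in> E. v \<in> en e}"

definition link :: "('e \<Rightarrow> 'v set) \<Rightarrow> 'e set \<Rightarrow> ('v \<times> 'v) set" where
  "link en E = {(u, v). \<exists>e\<in>E. en e = {u, v}}"

definition reach :: "('e \<Rightarrow> 'v set) \<Rightarrow> 'e set \<Rightarrow> 'v \<Rightarrow> 'v set" where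
  "reach en E u = {v. (u, v) \<in> (link en E)\<^sup>*}"

lemma reach_refl [simp]: "v \<in> reach en E v"
  by (simp add: reach_def)

lemma reach_trans: "v \<in> reach en E u \<Longrightarrow> w \<in> reach en E v \<Longrightarrow> w \<in> reach en E u"
  by (auto simp: reach_def)

lemma reach_sym: "v \<in> reach en E u \<Longrightarrow> u \<in> reach en E v"
proof -
  have "sym (link en E)"
    by (auto simp: sym_def link_def insert_commute)
  then show "v \<in> reach en E u \<Longrightarrow> u \<in> reach en E v"
    unfolding reach_def using sym_rtrancl by (auto dest: symD)
qed

lemma reach_eq: "v \<in> reach en E u \<Longrightarrow> reach en E v = reach en E u"
  using reach_trans reach_sym by fast

lemma reach_edge: "e \<in> E \<Longrightarrow> en e = {u, v} \<Longrightarrow> v \<in> reach en E u"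
  unfolding reach_def link_def by auto

lemma reach_edge_ends:
  assumes "e \<in> E" "card (en e) = 2" "u \<in> en e" "v \<in> en e"
  shows "v \<in> reach en E u"
proof -
  obtain a b where "en e = {a, b}"
    using assms(2) by (meson card_2_iff)
  then show ?thesis
    using assms reach_edge[of e E en] by (auto simp: insert_commute)
qed

lemma reach_mono: "E \<subseteq> E' \<Longrightarrow> v \<in> reach en E u \<Longrightarrow> v \<in> reach en E' u"
  unfolding reach_def using rtrancl_mono[of "link en E" "link en E'"] by (auto simp: link_def)

text \<open>A set that no edge leaves contains the class of each of its vertices.\<close>

lemma reach_subset:
  assumes "\<And>e. e \<in> E \<Longrightarrow> en e \<inter> S \<noteq> {} \<Longrightarrow> en e \<subseteq> S" "u \<in> S"
  shows "reach en E u \<subseteq> S"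
proof
  fix v assume "v \<in> reach en E u"
  then have "(u, v) \<in> (link en E)\<^sup>*" by (simp add: reach_def)
  then show "v \<in> S"
    by (induction rule: rtrancl_induct) (use assms in \<open>auto simp: link_def\<close>)
qed

lemma reach_ends_subset:
  assumes "\<forall>e\<in>E. card (en e) = 2" "e \<in> E" "x \<in> en e" "x \<in> reach en E u"
  shows "en e \<subseteq> reach en E u"
proof
  fix y assume "y \<in> en e"
  then have "y \<in> reach en E x" using assms reach_edge_ends[of e E en x y] by auto
  then show "y \<in> reach en E u" using assms(4) reach_trans by metis
qed

lemma odd_card_sym_diff:
  assumes "finite A" "finite B"
  shows "odd (card (sym_diff A B)) \<longleftrightarrow> odd (card A) \<noteq> odd (card B)"
proof -
  have "card A = card (A - B) + card (A \<inter> B)" "card B = card (B - A) + card (A \<inter> B)"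
    using assms card_Int_Diff[of A B] card_Int_Diff[of B A] by (simp_all add: Int_commute)
  moreover have "card (sym_diff A B) = card (A - B) + card (B - A)"
    using assms by (intro card_Un_disjoint) auto
  ultimately show ?thesis by auto
qed

lemma odd_deg_sym_diff:
  assumes "finite A" "finite B"
  shows "odd (deg en (sym_diff A B) v) \<longleftrightarrow> odd (deg en A v) \<noteq> odd (deg en B v)"
proof -
  have "{e \<in> sym_diff A B. v \<in> en e} = sym_diff {e \<in> A. v \<in> en e} {e \<in> B. v \<in> en e}"
    by auto
  then show ?thesis
    using odd_card_sym_diff[of "{e \<in> A. v \<in> en e}" "{e \<in> B. v \<in> en e}"] assms
    by (simp add: deg_def)
qed

lemma deg_Un:
  assumes "finite A" "finite B" "A \<inter> B = {}"
  shows "deg en (A \<union> B) v = deg en A v + deg en B v"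
proof -
  have "{e \<in> A \<union> B. v \<in> en e} = {e \<in> A. v \<in> en e} \<union> {e \<in> B. v \<in> en e}" by auto
  then show ?thesis
    unfolding deg_def using assms by (simp add: card_Un_disjoint disjoint_iff)
qed

lemma deg_Diff:
  assumes "finite B" "A \<subseteq> B"
  shows "deg en (B - A) v + deg en A v = deg en B v"
  using deg_Un[of "B - A" A en v] assms
  by (metis Diff_disjoint Diff_partition finite_Diff finite_subset inf_commute sup_commute)

text \<open>The edges of a walk are added modulo 2: each inner visit of a vertex contributes two to its degree.\<close>

lemma walk_join:
  assumes "finite E" "v \<in> reach en E u"
  shows "\<exists>J\<subseteq>E. \<forall>w. odd (deg en J w) \<longleftrightarrow> u \<noteq> v \<and> w \<in> {u, v}"
proof -
  have "(u, v) \<in> (link en E)\<^sup>*" using assms by (simp add: reach_def)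
  then show ?thesis
  proof (induction rule: rtrancl_induct)
    case base
    show ?case by (intro exI[of _ "{}"]) (simp add: deg_def)
  next
    case (step x y)
    obtain J where J: "J \<subseteq> E" "\<And>w. odd (deg en J w) \<longleftrightarrow> u \<noteq> x \<and> w \<in> {u, x}"
      using step.IH by auto
    obtain e where e: "e \<in> E" "en e = {x, y}" using step.hyps by (auto simp: link_def)
    show ?case
    proof (cases "x = y")
      case True
      then show ?thesis using J by auto
    next
      case False
      have de: "odd (deg en {e} w) \<longleftrightarrow> w \<in> {x, y}" for w
      proof -
        have "{f \<in> {e}. w \<in> en f} = (if w \<in> {x, y} then {e} else {})" using e by auto
        then show ?thesis by (simp add: deg_def)
      qed
      have "odd (deg en (sym_diff J {e}) w) \<longleftrightarrow> u \<noteq> y \<and> w \<in> {u, y}" for w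
        using odd_deg_sym_diff[of J "{e}" en w] J de[of w] False finite_subset[OF J(1) assms(1)]
        by auto
      then show ?thesis using J(1) e(1) by (intro exI[of _ "sym_diff J {e}"]) auto
    qed
  qed
qed

text \<open>The vertices of \<open>T\<close> are paired up within the connectivity classes; the sum modulo 2 of walks
  joining the pairs is the required set.\<close>

lemma T_join_exists:
  assumes "finite E" "finite T" "\<And>u. u \<in> T \<Longrightarrow> even (card (T \<inter> reach en E u))"
  shows "\<exists>J\<subseteq>E. \<forall>w. odd (deg en J w) \<longleftrightarrow> w \<in> T"
  using assms(2,3)
proof (induction "card T" arbitrary: T rule: less_induct)
  case less
  show ?case
  proof (cases "T = {}")
    case True
    then show ?thesis by (intro exI[of _ "{}"]) (simp add: deg_def)
  next
    case False
    then obtain u where u: "u \<in> T" by auto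
    have "T \<inter> reach en E u \<noteq> {u}"
    proof
      assume "T \<inter> reach en E u = {u}"
      with less.prems(2)[OF u] show False by simp
    qed
    then obtain v where v: "v \<in> T" "v \<in> reach en E u" "v \<noteq> u" using u by auto
    let ?T = "T - {u, v}"
    have "even (card (?T \<inter> reach en E w))" if "w \<in> ?T" for w
    proof (cases "u \<in> reach en E w")
      case True
      then have "v \<in> reach en E w" using v reach_trans by metis
      then have "{u, v} \<subseteq> T \<inter> reach en E w" "?T \<inter> reach en E w = T \<inter> reach en E w - {u, v}"
        using True u v by auto
      then have "card (T \<inter> reach en E w) = card (?T \<inter> reach en E w) + card {u, v}"
        using less.prems(1) by (metis card_Diff_subset card_mono finite.emptyI finite_Int
          finite_insert le_add_diff_inverse2)
      then show ?thesis using less.prems(2)[of w] that v by simp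
    next
      case False
      then have "v \<notin> reach en E w" using v reach_trans reach_sym by metis
      then have "?T \<inter> reach en E w = T \<inter> reach en E w" using False by auto
      then show ?thesis using less.prems(2)[of w] that by simp
    qed
    moreover have "card ?T < card T" using u less.prems(1) by (intro psubset_card_mono) auto
    ultimately obtain J where J: "J \<subseteq> E" "\<And>w. odd (deg en J w) \<longleftrightarrow> w \<in> ?T"
      using less.hyps[of ?T] less.prems(1) by auto
    obtain I where I: "I \<subseteq> E" "\<And>w. odd (deg en I w) \<longleftrightarrow> w \<in> {u, v}"
      using walk_join[OF assms(1) v(2)] v(3) by auto
    have "odd (deg en (sym_diff J I) w) \<longleftrightarrow> w \<in> T" for w
      using odd_deg_sym_diff[of J I en w] J I u v finite_subset[OF _ assms(1)] by auto
    then show ?thesis using J(1) I(1) by (intro exI[of _ "sym_diff J I"]) auto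
  qed
qed

lemma sum_deg:
  assumes "finite E" "finite Z"
  shows "(\<Sum>v\<in>Z. deg en E v) = (\<Sum>e\<in>E. card (en e \<inter> Z))"
proof -
  have "(\<Sum>v\<in>Z. deg en E v) = (\<Sum>v\<in>Z. \<Sum>e\<in>E. if v \<in> en e then 1 else 0)"
    using assms by (simp add: deg_def sum.If_cases Int_def)
  also have "\<dots> = (\<Sum>e\<in>E. \<Sum>v\<in>Z. if v \<in> en e then 1 else 0)"
    by (rule sum.swap)
  also have "\<dots> = (\<Sum>e\<in>E. card (en e \<inter> Z))"
    using assms by (simp add: sum.If_cases Int_def conj_commute)
  finally show ?thesis .
qed

text \<open>Handshaking, for a set \<open>Z\<close> that no edge leaves.\<close>

lemma even_sum_deg:
  assumes "finite E" "finite Z" "\<And>e. e \<in> E \<Longrightarrow> card (en e) = 2"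
    and "\<And>e. e \<in> E \<Longrightarrow> en e \<inter> Z \<noteq> {} \<Longrightarrow> en e \<subseteq> Z"
  shows "even (\<Sum>v\<in>Z. deg en E v)"
  unfolding sum_deg[OF assms(1,2)]
proof (rule dvd_sum)
  fix e assume e: "e \<in> E"
  show "even (card (en e \<inter> Z))"
  proof (cases "en e \<inter> Z = {}")
    case False
    then have "en e \<inter> Z = en e" using assms(4)[OF e] by auto
    then show ?thesis using assms(3)[OF e] by simp
  qed simp
qed

lemma odd_sum_card:
  assumes "finite A"
  shows "odd (sum f A) \<longleftrightarrow> odd (card {x \<in> A. odd (f x :: nat)})"
  using assms
proof (induction A rule: finite_induct)
  case (insert a A)
  have "{x \<in> insert a A. odd (f x)} = (if odd (f a) then insert a {x \<in> A. odd (f x)} else {x \<in> A. odd (f x)})"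
    by auto
  then show ?case using insert by simp
qed simp

section \<open>Even sets from typed matching edges\<close>

text \<open>For each type, a \<open>T\<close>-join inside the even set \<open>R t\<close> and its complement in \<open>R t\<close> have the same
  parities, so both complete the matching edges of that type to an even set. A matching edge
  is then covered twice by its own type, and an edge of \<open>B\<close> once by each of its two types.\<close>

lemma six_even_sets:
  fixes R :: "nat \<Rightarrow> 'e set" and ty :: "'e \<Rightarrow> nat"
  assumes fin: "finite E" "finite V"
    and "B \<subseteq> E" and ends: "\<And>e. e \<in> E \<Longrightarrow> en e \<subseteq> V"
    and matching: "\<And>v. deg en (E - B) v \<le> 1"
    and ty: "\<And>e. e \<in> E - B \<Longrightarrow> ty e < 3"
    and R: "\<And>t. t < 3 \<Longrightarrow> R t \<subseteq> B" "\<And>t v. t < 3 \<Longrightarrow> even (deg en (R t) v)"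
    and twice: "\<And>e. e \<in> B \<Longrightarrow> card {t. t < 3 \<and> e \<in> R t} = 2"
    and even_ends: "\<And>t u. t < 3 \<Longrightarrow> u \<in> V \<Longrightarrow> deg en {e \<in> E - B. ty e = t} u = 1 \<Longrightarrow>
      even (card {v \<in> reach en (R t) u. deg en {e \<in> E - B. ty e = t} v = 1})"
  shows "\<exists>X. (\<forall>i<6. X i \<subseteq> E \<and> (\<forall>v. even (deg en (X i) v))) \<and>
    (\<forall>e\<in>E. card {i. i < (6::nat) \<and> e \<in> X i} = 2)"
proof -
  define M where "M t = {e \<in> E - B. ty e = t}" for t
  have M1: "deg en (M t) v \<le> 1" for t v
  proof -
    have "deg en (M t) v \<le> deg en (E - B) v"
      unfolding deg_def M_def using fin by (intro card_mono) auto
    then show ?thesis using matching[of v] by simp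
  qed
  define T where "T t = {v. deg en (M t) v = 1}" for t
  have TV: "T t \<subseteq> V" for t
  proof
    fix v assume "v \<in> T t"
    then have "{e \<in> M t. v \<in> en e} \<noteq> {}"
      unfolding T_def deg_def by (metis (mono_tags, lifting) card.empty mem_Collect_eq zero_neq_one)
    then show "v \<in> V" using ends unfolding M_def by auto
  qed
  have finT: "finite (T t)" for t using TV finite_subset fin by blast
  have finR: "finite (R t)" if "t < 3" for t using R(1)[OF that] assms(3) fin finite_subset by metis
  have "\<exists>J\<subseteq>R t. \<forall>w. odd (deg en J w) \<longleftrightarrow> w \<in> T t" if t: "t < 3" for t
  proof (rule T_join_exists[OF finR[OF t] finT])
    fix u assume u: "u \<in> T t"
    then have "even (card {v \<in> reach en (R t) u. deg en (M t) v = 1})"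
      using even_ends[OF t, of u] TV unfolding T_def M_def by auto
    then show "even (card (T t \<inter> reach en (R t) u))"
      unfolding T_def by (simp add: Int_def conj_commute)
  qed
  then obtain J where J: "\<And>t. t < 3 \<Longrightarrow> J t \<subseteq> R t"
    "\<And>t w. t < 3 \<Longrightarrow> odd (deg en (J t) w) \<longleftrightarrow> w \<in> T t" by metis
  define X where "X i = (if i < 3 then M i \<union> J i else M (i - 3) \<union> (R (i - 3) - J (i - 3)))"
    for i :: nat
  have MR: "M s \<inter> R t = {}" if "t < 3" for s t using R(1)[OF that] by (auto simp: M_def)
  have finM: "finite (M t)" for t using fin by (simp add: M_def)
  have oddM: "odd (deg en (M t) v) \<longleftrightarrow> v \<in> T t" for t v
    using M1[of t v] unfolding T_def by (auto simp: le_Suc_eq)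
  have e1: "even (deg en (M t \<union> J t) v)" if "t < 3" for t v
    using deg_Un[of "M t" "J t" en v] finM finR[OF that] J[OF that] MR[OF that] oddM
    by (metis (no_types, lifting) disjoint_iff even_add finite_subset subset_iff)
  have e2: "even (deg en (M t \<union> (R t - J t)) v)" if "t < 3" for t v
  proof -
    have "deg en (M t \<union> (R t - J t)) v = deg en (M t) v + deg en (R t - J t) v"
      using MR[OF that, of t] finM finR[OF that] by (intro deg_Un) auto
    moreover have "deg en (R t - J t) v + deg en (J t) v = deg en (R t) v"
      using J(1)[OF that] finR[OF that] by (intro deg_Diff)
    ultimately show ?thesis using oddM[of t v] J(2)[OF that, of v] R(2)[OF that, of v]
      by (metis even_add)
  qed
  have "X i \<subseteq> E \<and> (\<forall>v. even (deg en (X i) v))" if "i < 6" for i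
  proof (cases "i < 3")
    case True
    then show ?thesis using e1[OF True] J(1)[OF True] R(1)[OF True] assms(3)
      unfolding X_def M_def by auto
  next
    case False
    then have "i - 3 < 3" using that by simp
    then show ?thesis using False e2 R(1)[of "i - 3"] assms(3) unfolding X_def M_def by auto
  qed
  moreover have "card {i. i < (6::nat) \<and> e \<in> X i} = 2" if e: "e \<in> E" for e
  proof (cases "e \<in> B")
    case False
    have "e \<in> X i \<longleftrightarrow> i = ty e \<or> i = ty e + 3" if "i < 6" for i
    proof (cases "i < 3")
      case True
      then show ?thesis using False e R(1)[OF True] J(1)[OF True] by (auto simp: X_def M_def)
    next
      case F: False
      then have "i - 3 < 3" using that by simp
      then have "e \<notin> R (i - 3)" using False R(1) by blast
      then show ?thesis using False F e ty[of e] by (auto simp: X_def M_def)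
    qed
    then have "{i. i < (6::nat) \<and> e \<in> X i} = {ty e, ty e + 3}"
      using False e ty[of e] by auto
    then show ?thesis by simp
  next
    case True
    have inj: "inj_on (\<lambda>t. if e \<in> J t then t else t + 3) {t. t < 3 \<and> e \<in> R t}"
      by (auto simp: inj_on_def split: if_splits)
    have "{i. i < (6::nat) \<and> e \<in> X i} = (\<lambda>t. if e \<in> J t then t else t + 3) ` {t. t < 3 \<and> e \<in> R t}"
      (is "?L = ?R")
    proof
      show "?L \<subseteq> ?R"
      proof
        fix i assume i: "i \<in> ?L"
        show "i \<in> ?R"
        proof (cases "i < 3")
          case T: True
          then have "e \<in> J i" using i True by (auto simp: X_def M_def)
          then show ?thesis using T J(1)[OF T] by (intro image_eqI[of _ _ i]) auto
        next
          case F: False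
          then have "e \<in> R (i - 3) - J (i - 3)" "i - 3 < 3" using i True by (auto simp: X_def M_def)
          then show ?thesis using F by (intro image_eqI[of _ _ "i - 3"]) auto
        qed
      qed
      show "?R \<subseteq> ?L" by (auto simp: X_def)
    qed
    then show ?thesis using card_image[OF inj] twice[OF True] by simp
  qed
  ultimately show ?thesis by (intro exI[of _ X]) auto
qed

section \<open>Parities of types\<close>

lemma three_distinct:
  assumes "{a, b, c} = {0, 1, 2::nat}"
  shows "a \<noteq> b" "a \<noteq> c" "b \<noteq> c" "a < 3" "b < 3" "c < 3" "t < 3 \<longleftrightarrow> t = a \<or> t = b \<or> t = c"
proof -
  have "card {a, b, c} = 3" using assms by simp
  then show "a \<noteq> b" "a \<noteq> c" "b \<noteq> c" by (auto simp: card_insert_if split: if_splits)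
  have "t < 3 \<longleftrightarrow> t \<in> {a, b, c}" for t unfolding assms by auto
  then show "a < 3" "b < 3" "c < 3" "t < 3 \<longleftrightarrow> t = a \<or> t = b \<or> t = c" by blast+
qed

lemma card_by_three_values:
  assumes "finite S" "\<And>v. v \<in> S \<Longrightarrow> f v < (3::nat)" "{a, b, c} = {0, 1, 2::nat}"
  shows "card S = card {v \<in> S. f v = a} + card {v \<in> S. f v = b} + card {v \<in> S. f v = c}"
proof -
  note d = three_distinct(1-3)[OF assms(3)]
  have "f v = a \<or> f v = b \<or> f v = c" if "v \<in> S" for v
  proof -
    have "f v \<in> {0, 1, 2}" using assms(2)[OF that] by auto
    then show ?thesis using assms(3) by auto
  qed
  then have "S = ({v \<in> S. f v = a} \<union> {v \<in> S. f v = b}) \<union> {v \<in> S. f v = c}" by auto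
  also have "card \<dots> = card ({v \<in> S. f v = a} \<union> {v \<in> S. f v = b}) + card {v \<in> S. f v = c}"
    using assms(1) d by (intro card_Un_disjoint) auto
  also have "card ({v \<in> S. f v = a} \<union> {v \<in> S. f v = b}) = card {v \<in> S. f v = a} + card {v \<in> S. f v = b}"
    using assms(1) d by (intro card_Un_disjoint) auto
  finally show ?thesis by simp
qed

lemma third_value:
  assumes "a < (3::nat)" "b < 3" "a \<noteq> b"
  shows "{a, b, 3 - a - b} = {0, 1, 2}"
proof -
  have "a = 0 \<or> a = 1 \<or> a = 2" "b = 0 \<or> b = 1 \<or> b = 2" using assms by auto
  then show ?thesis using assms by auto
qed

lemma avoid_two: "\<exists>t<(3::nat). t \<noteq> a \<and> t \<noteq> b"
proof -
  have "\<not> {0, 1, 2} \<subseteq> {a, b}"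
  proof
    assume "{0, 1, 2} \<subseteq> {a, b}"
    then have "card {0, 1, 2::nat} \<le> card {a, b}" by (intro card_mono) auto
    then show False by (simp add: card_insert_if split: if_splits)
  qed
  then obtain t where "t \<in> {0, 1, 2}" "t \<notin> {a, b}" by blast
  then show ?thesis by (intro exI[of _ t]) auto
qed

lemma ex_if_odd_card:
  assumes "odd (card {v \<in> A. P v})"
  shows "\<exists>v\<in>A. P v"
proof (rule ccontr)
  assume "\<not> ?thesis"
  then have "{v \<in> A. P v} = {}" by blast
  then show False using assms by (simp only: card.empty) simp
qed

text \<open>One side of a piece from which the type \<open>z\<close> is omitted. Attachments of colour \<open>j\<close> are forced to
  type \<open>k\<close> and vice versa, while those of colour \<open>z\<close> are free; so the parities \<open>p\<close> are attained as
  soon as a free attachment exists, and otherwise only if the forced choice has them.\<close>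

lemma side_types:
  assumes "finite S" and col: "\<And>v. v \<in> S \<Longrightarrow> col v < 3" and ojk: "{z, j, k} = {0, 1, 2::nat}"
    and p: "\<not> p z" "odd (card S) \<longleftrightarrow> p j \<noteq> p k"
    and feasible: "(\<exists>v\<in>S. col v = z) \<or> (odd (card {v \<in> S. col v = j}) \<longleftrightarrow> p k)"
  shows "\<exists>\<tau>. (\<forall>v\<in>S. \<tau> v < 3 \<and> \<tau> v \<noteq> z \<and> \<tau> v \<noteq> col v) \<and>
    (\<forall>t<3. odd (card {v \<in> S. \<tau> v = t}) \<longleftrightarrow> p t)"
proof -
  note d = three_distinct[OF ojk]
  have suff: ?thesis if \<tau>: "\<And>v. v \<in> S \<Longrightarrow> \<tau> v \<in> {j, k} \<and> \<tau> v \<noteq> col v"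
    and k: "odd (card {v \<in> S. \<tau> v = k}) \<longleftrightarrow> p k" for \<tau>
  proof -
    have lt: "\<And>v. v \<in> S \<Longrightarrow> \<tau> v < 3" using \<tau> d by auto
    have z: "{v \<in> S. \<tau> v = z} = {}" using \<tau> d by auto
    have "card S = card {v \<in> S. \<tau> v = j} + card {v \<in> S. \<tau> v = k}"
      using card_by_three_values[OF assms(1) _ ojk, of \<tau>] lt unfolding z by simp
    then have pj: "odd (card {v \<in> S. \<tau> v = j}) \<longleftrightarrow> p j" using p k by auto
    then have "odd (card {v \<in> S. \<tau> v = t}) \<longleftrightarrow> p t" if lt3: "t < 3" for t
    proof -
      have ev: "even (card {v \<in> S. \<tau> v = z})" unfolding z by simp
      consider "t = z" | "t = j" | "t = k" using d(7)[of t] lt3 by blast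
      then show ?thesis using ev k pj p(1) by cases simp_all
    qed
    moreover have "\<tau> v < 3 \<and> \<tau> v \<noteq> z \<and> \<tau> v \<noteq> col v" if "v \<in> S" for v
      using \<tau>[OF that] lt[OF that] d(1,2) by auto
    ultimately show ?thesis by blast
  qed
  \<comment> \<open>The free attachments start with type \<open>j\<close>; if the parity is wrong, one of them is changed to \<open>k\<close>.\<close>
  define \<sigma> where "\<sigma> v = (if col v = j then k else j)" for v
  have \<sigma>k: "{v \<in> S. \<sigma> v = k} = {v \<in> S. col v = j}" using d by (auto simp: \<sigma>_def)
  show ?thesis
  proof (cases "odd (card {v \<in> S. col v = j}) \<longleftrightarrow> p k")
    case True
    show ?thesis by (rule suff[of \<sigma>]) (use True \<sigma>k d in \<open>auto simp: \<sigma>_def\<close>)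
  next
    case False
    then obtain v0 where v0: "v0 \<in> S" "col v0 = z" using feasible by auto
    have "{v \<in> S. (\<sigma>(v0 := k)) v = k} = insert v0 {v \<in> S. col v = j}"
      using v0 d by (auto simp: \<sigma>_def)
    moreover have "v0 \<notin> {v \<in> S. col v = j}" using v0 d by auto
    ultimately have "card {v \<in> S. (\<sigma>(v0 := k)) v = k} = Suc (card {v \<in> S. col v = j})"
      using assms(1) by simp
    then show ?thesis
      using False v0 d by (intro suff[of "\<sigma>(v0 := k)"]) (auto simp: \<sigma>_def)
  qed
qed

text \<open>If the colour classes are not all even, then two of them are odd and hence nonempty. Thus at most
  one type cannot be omitted on a given side with even contributions, and two sides leave a common
  choice among the three types.\<close>

lemma feasible_all_but_one:
  assumes "finite S" "\<And>v. v \<in> S \<Longrightarrow> col v < (3::nat)" "even (card S)"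
  shows "\<exists>b. \<forall>z<3. z \<noteq> b \<longrightarrow> (\<exists>v\<in>S. col v = z) \<or> (\<forall>j<3. even (card {v \<in> S. col v = j}))"
proof -
  define n where "n t = card {v \<in> S. col v = t}" for t
  have *: "t < 3 \<longleftrightarrow> t = 0 \<or> t = 1 \<or> t = 2" for t :: nat by auto
  have "even (n 0 + n 1 + n 2)"
    using card_by_three_values[of S col 0 1 2] assms by (simp add: n_def)
  moreover have nz: "\<exists>v\<in>S. col v = t" if "odd (n t)" for t
    using ex_if_odd_card that unfolding n_def by fast
  ultimately consider "\<forall>j<3. even (n j)" | "odd (n 0)" "odd (n 1)" | "odd (n 0)" "odd (n 2)"
    | "odd (n 1)" "odd (n 2)"
    by (auto simp: *)
  then show ?thesis
    unfolding n_def[symmetric]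
  proof cases
    case 2
    then show "\<exists>b. \<forall>z<3. z \<noteq> b \<longrightarrow> (\<exists>v\<in>S. col v = z) \<or> (\<forall>j<3. even (n j))"
      using nz[of 0] nz[of 1] * by (intro exI[of _ 2]) auto
  next
    case 3
    then show "\<exists>b. \<forall>z<3. z \<noteq> b \<longrightarrow> (\<exists>v\<in>S. col v = z) \<or> (\<forall>j<3. even (n j))"
      using nz[of 0] nz[of 2] * by (intro exI[of _ 1]) auto
  next
    case 4
    then show "\<exists>b. \<forall>z<3. z \<noteq> b \<longrightarrow> (\<exists>v\<in>S. col v = z) \<or> (\<forall>j<3. even (n j))"
      using nz[of 1] nz[of 2] * by (intro exI[of _ 0]) auto
  qed blast
qed

lemma piece_types:
  assumes "finite S" "finite S'" "S \<inter> S' = {}" and col: "\<And>v. v \<in> S \<union> S' \<Longrightarrow> col v < 3"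
    and p: "odd (card S) \<longleftrightarrow> p j \<noteq> p k" "odd (card S') \<longleftrightarrow> p j \<noteq> p k" "\<not> p z"
      "{z, j, k} = {0, 1, 2::nat}"
    and "(\<exists>v\<in>S. col v = z) \<or> (odd (card {v \<in> S. col v = j}) \<longleftrightarrow> p k)"
    and "(\<exists>v\<in>S'. col v = z) \<or> (odd (card {v \<in> S'. col v = j}) \<longleftrightarrow> p k)"
  shows "\<exists>z<3. \<exists>\<tau>. (\<forall>v\<in>S \<union> S'. \<tau> v < 3 \<and> \<tau> v \<noteq> z \<and> \<tau> v \<noteq> col v) \<and>
    (\<forall>t<3. (odd (card {v \<in> S. \<tau> v = t}) \<longleftrightarrow> p t) \<and> (odd (card {v \<in> S'. \<tau> v = t}) \<longleftrightarrow> p t))"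
proof -
  obtain \<tau> where \<tau>: "\<forall>v\<in>S. \<tau> v < 3 \<and> \<tau> v \<noteq> z \<and> \<tau> v \<noteq> col v"
    "\<forall>t<3. odd (card {v \<in> S. \<tau> v = t}) \<longleftrightarrow> p t"
    using side_types[of S col z j k p] assms by blast
  obtain \<sigma> where \<sigma>: "\<forall>v\<in>S'. \<sigma> v < 3 \<and> \<sigma> v \<noteq> z \<and> \<sigma> v \<noteq> col v"
    "\<forall>t<3. odd (card {v \<in> S'. \<sigma> v = t}) \<longleftrightarrow> p t"
    using side_types[of S' col z j k p] assms by blast
  let ?\<rho> = "\<lambda>v. if v \<in> S then \<tau> v else \<sigma> v"
  have "{v \<in> S. ?\<rho> v = t} = {v \<in> S. \<tau> v = t}" "{v \<in> S'. ?\<rho> v = t} = {v \<in> S'. \<sigma> v = t}" for t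
    using assms(3) by auto
  then show ?thesis
    using \<tau> \<sigma> three_distinct[OF p(4)] by (intro exI[of _ z] conjI exI[of _ ?\<rho>]) auto
qed

lemma even_piece_types:
  assumes "finite S" "finite S'" "S \<inter> S' = {}" and col: "\<And>v. v \<in> S \<union> S' \<Longrightarrow> col v < (3::nat)"
    and "even (card S)" "even (card S')"
  shows "\<exists>z<3. \<exists>\<tau>. (\<forall>v\<in>S \<union> S'. \<tau> v < 3 \<and> \<tau> v \<noteq> z \<and> \<tau> v \<noteq> col v) \<and>
    (\<forall>t<3. even (card {v \<in> S. \<tau> v = t}) \<and> even (card {v \<in> S'. \<tau> v = t}))"
proof -
  obtain b where b: "\<And>z. z < 3 \<Longrightarrow> z \<noteq> b \<Longrightarrow> (\<exists>v\<in>S. col v = z) \<or> (\<forall>j<3. even (card {v \<in> S. col v = j}))"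
    using feasible_all_but_one[of S col] assms by blast
  obtain b' where b': "\<And>z. z < 3 \<Longrightarrow> z \<noteq> b' \<Longrightarrow> (\<exists>v\<in>S'. col v = z) \<or> (\<forall>j<3. even (card {v \<in> S'. col v = j}))"
    using feasible_all_but_one[of S' col] assms by blast
  obtain z where z: "z < 3" "z \<noteq> b" "z \<noteq> b'" using avoid_two by blast
  obtain j where j: "j < 3" "z \<noteq> j" using avoid_two[of z z] by blast
  have f: "(\<exists>v\<in>S. col v = z) \<or> even (card {v \<in> S. col v = j})"
    "(\<exists>v\<in>S'. col v = z) \<or> even (card {v \<in> S'. col v = j})"
    using b[OF z(1,2)] b'[OF z(1,3)] j by blast+
  show ?thesis
    using piece_types[of S S' col "\<lambda>_. False" j "3 - z - j" z] assms z j
      f third_value[OF z(1) j] by simp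
qed

text \<open>The type to omit is \<open>i\<close>: the first side then has free attachments. If the second side has none,
  then its only colours are \<open>t0\<close> and \<open>j\<close>; the attachments of colour \<open>j\<close>, which are odd in number,
  are the ones forced to type \<open>t0\<close>.\<close>

lemma odd_piece_types:
  assumes "finite S" "finite S'" "S \<inter> S' = {}" and col: "\<And>v. v \<in> S \<union> S' \<Longrightarrow> col v < (3::nat)"
    and "odd (card S)" "odd (card S')"
    and i: "odd (card {v \<in> S. col v = i})" and j: "odd (card {v \<in> S'. col v = j})"
    and t0: "t0 < 3" "t0 \<noteq> i" "t0 \<noteq> j"
  shows "\<exists>z<3. \<exists>\<tau>. (\<forall>v\<in>S \<union> S'. \<tau> v < 3 \<and> \<tau> v \<noteq> z \<and> \<tau> v \<noteq> col v) \<and>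
    (\<forall>t<3. (odd (card {v \<in> S. \<tau> v = t}) \<longleftrightarrow> t = t0) \<and> (odd (card {v \<in> S'. \<tau> v = t}) \<longleftrightarrow> t = t0))"
proof -
  have lt: "i < 3" "j < 3" using ex_if_odd_card[OF i] ex_if_odd_card[OF j] col by auto
  let ?m = "3 - i - t0"
  have three: "{i, ?m, t0} = {0, 1, 2}"
    using third_value[of i t0] lt t0 by (simp add: insert_commute)
  note d = three_distinct[OF three]
  have "(\<exists>v\<in>S'. col v = i) \<or> odd (card {v \<in> S'. col v = ?m})"
    using d(7)[of j] lt t0 j ex_if_odd_card[OF j] by auto
  then show ?thesis
    using piece_types[of S S' col "\<lambda>t. t = t0" ?m t0 i] assms d three ex_if_odd_card[OF i] by simp
qed

lemma permutation_with_two_values: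
  assumes "a < (3::nat)" "b < 3" "a \<noteq> b" "c < (3::nat)" "d < 3" "c \<noteq> d"
  shows "\<exists>\<pi>. bij_betw \<pi> {..<3} {..<(3::nat)} \<and> \<pi> a = c \<and> \<pi> b = d"
proof -
  define x where "x = 3 - a - b"
  define y where "y = 3 - c - d"
  have x: "{a, b, x} = {0, 1, 2}" and y: "{c, d, y} = {0, 1, 2}"
    using third_value assms by (auto simp: x_def y_def)
  note dx = three_distinct[OF x] and dy = three_distinct[OF y]
  have lt3: "{..<3} = {0, 1, 2::nat}" by auto
  define \<pi> where "\<pi> t = (if t = a then c else if t = b then d else y)" for t
  have "inj_on \<pi> {a, b, x}" using dx(1-3) dy(1-3) by (auto simp: \<pi>_def inj_on_def)
  moreover have "\<pi> ` {a, b, x} = {c, d, y}" using dx(1-3) by (auto simp: \<pi>_def)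
  ultimately have "bij_betw \<pi> {..<3} {..<3}" unfolding bij_betw_def lt3 x[symmetric] y[symmetric]
    using x y by simp
  then show ?thesis using assms by (intro exI[of _ \<pi>]) (auto simp: \<pi>_def)
qed

lemma odd_card_upd:
  assumes "finite I" "D \<in> I"
  shows "odd (card {x \<in> I. (f(D := y)) x = t}) \<longleftrightarrow> odd (card {x \<in> I - {D}. f x = t}) \<noteq> (y = t)"
proof -
  have "{x \<in> I. (f(D := y)) x = t} = (if y = t then insert D {x \<in> I - {D}. f x = t} else {x \<in> I - {D}. f x = t})"
    using assms by auto
  then show ?thesis using assms by simp
qed

text \<open>All values avoid \<open>a\<close>, so only two values occur; the choice at \<open>D\<close> between these two repairs the
  parity.\<close>

lemma balance_one_free:
  assumes "finite I" "even (card I)" "a < 3" "D \<in> I"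
    and q: "\<And>x. x \<in> I \<Longrightarrow> r x = a \<or> s x = a" "r D = a" "s D = a"
  shows "\<exists>f. (\<forall>x\<in>I. f x < (3::nat) \<and> f x \<noteq> r x \<and> f x \<noteq> s x) \<and> (\<forall>t<3. even (card {x \<in> I. f x = t}))"
proof -
  have "\<exists>f. \<forall>x. f x < (3::nat) \<and> f x \<noteq> r x \<and> f x \<noteq> s x"
    using avoid_two by (intro choice allI) blast
  then obtain f where f: "\<And>x. f x < (3::nat)" "\<And>x. f x \<noteq> r x" "\<And>x. f x \<noteq> s x" by auto
  define j where "j = (if a = 0 then 1 else 0::nat)"
  define k where "k = 3 - a - j"
  have three: "{a, j, k} = {0, 1, 2}" using third_value[of a j] assms(3) by (auto simp: j_def k_def)
  note d = three_distinct[OF three]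
  let ?n = "\<lambda>t. card {x \<in> I - {D}. f x = t}"
  have "f x \<noteq> a" if "x \<in> I" for x using q(1)[OF that] f(2,3)[of x] by auto
  then have a0: "{x \<in> I - {D}. f x = a} = {}" by auto
  have "card (I - {D}) = ?n a + ?n j + ?n k"
    using card_by_three_values[of "I - {D}" f a j k] assms(1) f(1) three by simp
  moreover have "card I = Suc (card (I - {D}))" using card.remove[OF assms(1,4)] .
  ultimately have jk: "odd (?n j) \<noteq> odd (?n k)" using assms(2) unfolding a0 by auto
  define y where "y = (if odd (?n j) then j else k)"
  have "even (card {x \<in> I. (f(D := y)) x = t})" if "t < 3" for t
  proof -
    consider "t = a" | "t = j" | "t = k" using \<open>t < 3\<close> d(7) by blast
    then have "odd (?n t) \<longleftrightarrow> y = t"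
    proof cases
      case 1
      have "?n a = 0" unfolding a0 by simp
      then show ?thesis using 1 d(1,2) by (simp add: y_def)
    qed (use jk d(3) in \<open>auto simp: y_def\<close>)
    then show ?thesis using odd_card_upd[OF assms(1,4), of f y t] by simp
  qed
  moreover have "\<forall>x\<in>I. (f(D := y)) x < 3 \<and> (f(D := y)) x \<noteq> r x \<and> (f(D := y)) x \<noteq> s x"
    using f d q by (auto simp: y_def)
  ultimately show ?thesis by blast
qed

text \<open>At \<open>D\<close> every value but \<open>a\<close> is free and at \<open>D'\<close> every value but \<open>b\<close>. The other elements of \<open>I\<close>, even
  in number, leave either no parity or two parities to be repaired, and in each case the values of \<open>D\<close>
  and \<open>D'\<close> can be chosen to do so.\<close>

lemma balance_two_free:
  assumes "finite I" "even (card I)" "a < 3" "b < 3" "a \<noteq> b" and D: "D \<in> I" "D' \<in> I"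
    and q: "r D = a" "s D = a" "r D' = b" "s D' = b"
  shows "\<exists>f. (\<forall>x\<in>I. f x < (3::nat) \<and> f x \<noteq> r x \<and> f x \<noteq> s x) \<and> (\<forall>t<3. even (card {x \<in> I. f x = t}))"
proof -
  have "\<exists>f. \<forall>x. f x < (3::nat) \<and> f x \<noteq> r x \<and> f x \<noteq> s x"
    using avoid_two by (intro choice allI) blast
  then obtain f where f: "\<And>x. f x < (3::nat)" "\<And>x. f x \<noteq> r x" "\<And>x. f x \<noteq> s x" by auto
  define c where "c = 3 - a - b"
  have three: "{a, b, c} = {0, 1, 2}" using third_value assms by (auto simp: c_def)
  note d = three_distinct[OF three]
  have ne: "D \<noteq> D'" using q assms(5) by auto
  define n where "n t = card {x \<in> I - {D} - {D'}. f x = t}" for t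
  have card: "card (I - {D} - {D'}) = n a + n b + n c"
    using card_by_three_values[of "I - {D} - {D'}" f a b c] assms(1) f(1) three by (simp add: n_def)
  have "card I = Suc (card (I - {D}))" using card.remove[OF assms(1) D(1)] .
  moreover have "card (I - {D}) = Suc (card (I - {D} - {D'}))"
    using card.remove[of "I - {D}" D'] ne D assms(1) by simp
  ultimately have par: "even (n a + n b + n c)" using card assms(2) by simp
  have "\<exists>y y'. y < 3 \<and> y' < 3 \<and> y \<noteq> a \<and> y' \<noteq> b \<and> (\<forall>t<3. odd (n t) \<longleftrightarrow> (y' = t) \<noteq> (y = t))"
  proof -
    have *: ?thesis if "y \<in> {b, c}" "y' \<in> {a, c}" "\<And>t. t \<in> {a, b, c} \<Longrightarrow> odd (n t) \<longleftrightarrow> (y' = t) \<noteq> (y = t)"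
      for y y'
    proof -
      have "\<forall>t<3. odd (n t) \<longleftrightarrow> (y' = t) \<noteq> (y = t)" using that(3) d(7) by blast
      moreover have "y < 3" "y' < 3" "y \<noteq> a" "y' \<noteq> b" using that(1,2) d(1-6) by auto
      ultimately show ?thesis by blast
    qed
    consider "odd (n a)" "odd (n b)" "even (n c)" | "odd (n a)" "even (n b)" "odd (n c)"
      | "even (n a)" "odd (n b)" "odd (n c)" | "even (n a)" "even (n b)" "even (n c)"
      using par by auto
    then show ?thesis
    proof cases
      case 1 show ?thesis by (rule *[of b a]) (use 1 d in auto)
    next
      case 2 show ?thesis by (rule *[of c a]) (use 2 d in auto)
    next
      case 3 show ?thesis by (rule *[of b c]) (use 3 d in auto)
    next
      case 4 show ?thesis by (rule *[of c c]) (use 4 d in auto)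
    qed
  qed
  then obtain y y' where y: "y < 3" "y' < 3" "y \<noteq> a" "y' \<noteq> b"
    "\<And>t. t < 3 \<Longrightarrow> odd (n t) \<longleftrightarrow> (y' = t) \<noteq> (y = t)" by auto
  let ?f = "f(D' := y', D := y)"
  have "even (card {x \<in> I. ?f x = t})" if "t < 3" for t
    using odd_card_upd[OF assms(1) D(1), of "f(D' := y')" y t]
      odd_card_upd[of "I - {D}" D' f y' t] y(5)[OF that] D ne assms(1)
    by (simp add: n_def del: fun_upd_apply) blast
  moreover have "\<forall>x\<in>I. ?f x < 3 \<and> ?f x \<noteq> r x \<and> ?f x \<noteq> s x"
    using f y q by auto
  ultimately show ?thesis by blast
qed

text \<open>Regard \<open>(r x, s x)\<close> as positions in a 3 by 3 table. Two positions in different rows and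
  different columns can both be moved to the diagonal by a permutation of the columns, where
  only one type is forbidden. If there are no two such positions, all of them lie in one row or in one
  column, and one of them is moved to the diagonal.\<close>

lemma balanced_types:
  fixes r s :: "'a \<Rightarrow> nat"
  assumes "finite I" "even (card I)" and r: "\<And>x. x \<in> I \<Longrightarrow> r x < 3" and s: "\<And>x. x \<in> I \<Longrightarrow> s x < 3"
  shows "\<exists>\<pi> f. bij_betw \<pi> {..<3} {..<3::nat} \<and> (\<forall>x\<in>I. f x < 3 \<and> f x \<noteq> r x \<and> f x \<noteq> \<pi> (s x)) \<and>
    (\<forall>t<3. even (card {x \<in> I. f x = t}))"
proof (cases "\<exists>D\<in>I. \<exists>D'\<in>I. r D \<noteq> r D' \<and> s D \<noteq> s D'")
  case True
  then obtain D D' where D: "D \<in> I" "D' \<in> I" "r D \<noteq> r D'" "s D \<noteq> s D'" by auto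
  obtain \<pi> where \<pi>: "bij_betw \<pi> {..<3} {..<3::nat}" "\<pi> (s D) = r D" "\<pi> (s D') = r D'"
    using permutation_with_two_values[of "s D" "s D'" "r D" "r D'"] D r s by blast
  have "\<exists>f. (\<forall>x\<in>I. f x < 3 \<and> f x \<noteq> r x \<and> f x \<noteq> \<pi> (s x)) \<and> (\<forall>t<3. even (card {x \<in> I. f x = t}))"
    using assms(1,2) D r \<pi>(2,3) by (intro balance_two_free[of I "r D" "r D'" D D']) simp_all
  then show ?thesis using \<pi>(1) by blast
next
  case False
  show ?thesis
  proof (cases "I = {}")
    case True
    then show ?thesis by (intro exI[of _ id]) auto
  next
    case F: False
    then obtain D where D: "D \<in> I" by auto
    have "(\<forall>x\<in>I. r x = r D) \<or> (\<forall>x\<in>I. s x = s D)" using False D by metis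
    obtain \<pi> where \<pi>: "bij_betw \<pi> {..<3} {..<3::nat}" "\<pi> (s D) = r D"
    proof -
      obtain a b where "a < 3" "a \<noteq> s D" "b < 3" "b \<noteq> r D" using avoid_two by blast
      then show ?thesis
        using permutation_with_two_values[of "s D" a "r D" b] D r s that by (metis (no_types))
    qed
    have "\<exists>f. (\<forall>x\<in>I. f x < 3 \<and> f x \<noteq> r x \<and> f x \<noteq> \<pi> (s x)) \<and> (\<forall>t<3. even (card {x \<in> I. f x = t}))"
      using assms(1,2) D r \<pi>(2) \<open>(\<forall>x\<in>I. r x = r D) \<or> _\<close>
      by (intro balance_one_free[of I "r D" D]) auto
    then show ?thesis using \<pi>(1) by blast
  qed
qed

section \<open>Frames with two Kotzig parts\<close>

text \<open>\<open>U\<close> itself admits a \<open>T\<close>-join, to which handshaking applies.\<close>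

lemma even_card_Un_classes:
  assumes "finite E" "finite U" "\<And>e. e \<in> E \<Longrightarrow> card (en e) = 2"
    and "\<And>v. v \<in> U \<Longrightarrow> reach en E v \<subseteq> U \<and> even (card (reach en E v))"
  shows "even (card U)"
proof -
  have "U \<inter> reach en E u = reach en E u" if "u \<in> U" for u
    using assms(4)[OF that] by auto
  then have "\<exists>J\<subseteq>E. \<forall>w. odd (deg en J w) \<longleftrightarrow> w \<in> U"
    using assms(4) by (intro T_join_exists assms(1,2)) simp
  then obtain J where J: "J \<subseteq> E" "\<And>w. odd (deg en J w) \<longleftrightarrow> w \<in> U" by auto
  have "en e \<subseteq> U" if e: "e \<in> J" "en e \<inter> U \<noteq> {}" for e
  proof -
    obtain x where x: "x \<in> en e" "x \<in> U" using e by auto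
    then have "en e \<subseteq> reach en E x"
      using reach_ends_subset[of E en e x x] assms(3) J(1) e by auto
    then show ?thesis using assms(4)[OF x(2)] by auto
  qed
  then have "even (\<Sum>v\<in>U. deg en J v)"
    using J(1) assms(1-3) finite_subset by (intro even_sum_deg) auto
  moreover have "{v \<in> U. odd (deg en J v)} = U" using J(2) by auto
  ultimately show ?thesis using odd_sum_card[OF assms(2), of "deg en J"] by simp
qed

lemma card_by_classes:
  assumes "finite V" "U \<subseteq> V"
  shows "card U = (\<Sum>D\<in>reach en E ` V. card (D \<inter> U))"
proof -
  have "U = (\<Union>D\<in>reach en E ` V. D \<inter> U)" using assms(2) by auto
  also have "card \<dots> = (\<Sum>D\<in>reach en E ` V. card (D \<inter> U))"
  proof (rule card_UN_disjoint)
    show "\<forall>D\<in>reach en E ` V. finite (D \<inter> U)" using assms finite_subset by blast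
    show "\<forall>D\<in>reach en E ` V. \<forall>D'\<in>reach en E ` V. D \<noteq> D' \<longrightarrow> D \<inter> U \<inter> (D' \<inter> U) = {}"
    proof (intro ballI impI, rule ccontr)
      fix D D' assume D: "D \<in> reach en E ` V" "D' \<in> reach en E ` V" "D \<noteq> D'"
        and "D \<inter> U \<inter> (D' \<inter> U) \<noteq> {}"
      then obtain x where "x \<in> D" "x \<in> D'" by auto
      then have "D = reach en E x" "D' = reach en E x" using D(1,2) reach_eq[of x en E] by auto
      then show False using D(3) by simp
    qed
  qed (use assms in simp)
  finally show ?thesis .
qed

text \<open>All that is needed of a coloured K-component with vertex set \<open>A\<close>: any two of the colours
  form an even set, whose edges are connected to each other. The empty set satisfies this
  as well and stands for a K-component that is not there.\<close>

definition kotzig_part :: "('e \<Rightarrow> 'v set) \<Rightarrow> 'e set \<Rightarrow> 'v set \<Rightarrow> ('e \<Rightarrow> nat) \<Rightarrow> bool" where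
  "kotzig_part en B A c \<longleftrightarrow>
     (\<forall>e\<in>B. en e \<subseteq> A \<longrightarrow> c e < 3) \<and>
     (\<forall>v\<in>A. \<exists>e\<in>B. v \<in> en e \<and> en e \<subseteq> A) \<and>
     (\<forall>t<3. \<forall>v. even (deg en {e \<in> B. en e \<subseteq> A \<and> c e \<noteq> t} v)) \<and>
     (\<forall>t<3. \<forall>e\<in>{e \<in> B. en e \<subseteq> A \<and> c e \<noteq> t}. \<forall>f\<in>{e \<in> B. en e \<subseteq> A \<and> c e \<noteq> t}.
        \<forall>u\<in>en e. \<forall>v\<in>en f. v \<in> reach en {e \<in> B. en e \<subseteq> A \<and> c e \<noteq> t} u)"

lemma kotzig_part_connected:
  assumes "kotzig_part en B A c" "t < 3"
    and "e \<in> {e \<in> B. en e \<subseteq> A \<and> c e \<noteq> t}" "f \<in> {e \<in> B. en e \<subseteq> A \<and> c e \<noteq> t}"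
    and "u \<in> en e" "v \<in> en f"
  shows "v \<in> reach en {e \<in> B. en e \<subseteq> A \<and> c e \<noteq> t} u"
  using assms(1)[unfolded kotzig_part_def, THEN conjunct2, THEN conjunct2, THEN conjunct2,
    rule_format, OF assms(2-)] .

lemma kotzig_part_permute:
  assumes "kotzig_part en B A c" and \<pi>: "bij_betw \<pi> {..<3} {..<3}"
  shows "kotzig_part en B A (\<pi> \<circ> c)"
proof -
  have c: "c e < 3" if "e \<in> B" "en e \<subseteq> A" for e using assms(1) that by (auto simp: kotzig_part_def)
  have lt: "\<pi> (c e) < 3" if "e \<in> B" "en e \<subseteq> A" for e
    using c[OF that] \<pi> by (auto simp: bij_betw_def)
  have ex: "\<exists>s<3. {e \<in> B. en e \<subseteq> A \<and> (\<pi> \<circ> c) e \<noteq> t} = {e \<in> B. en e \<subseteq> A \<and> c e \<noteq> s}" if "t < 3" for t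
  proof -
    have "t \<in> \<pi> ` {..<3}" using \<pi> \<open>t < 3\<close> by (simp add: bij_betw_def)
    then obtain s where s: "s < 3" "\<pi> s = t" by auto
    have "\<pi> (c e) = t \<longleftrightarrow> c e = s" if "e \<in> B" "en e \<subseteq> A" for e
      using s c[OF that] \<pi> unfolding bij_betw_def inj_on_def by auto
    then have "{e \<in> B. en e \<subseteq> A \<and> (\<pi> \<circ> c) e \<noteq> t} = {e \<in> B. en e \<subseteq> A \<and> c e \<noteq> s}" by auto
    then show ?thesis using s by blast
  qed
  show ?thesis
    unfolding kotzig_part_def
  proof (intro conjI)
    show "\<forall>t<3. \<forall>v. even (deg en {e \<in> B. en e \<subseteq> A \<and> (\<pi> \<circ> c) e \<noteq> t} v)"
    proof (intro allI impI)
      fix t :: nat and v assume "t < 3"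
      then obtain s where "s < 3" "{e \<in> B. en e \<subseteq> A \<and> (\<pi> \<circ> c) e \<noteq> t} = {e \<in> B. en e \<subseteq> A \<and> c e \<noteq> s}"
        using ex by blast
      then show "even (deg en {e \<in> B. en e \<subseteq> A \<and> (\<pi> \<circ> c) e \<noteq> t} v)"
        using assms(1) by (simp only: kotzig_part_def)
    qed
    show "\<forall>t<3. \<forall>e\<in>{e \<in> B. en e \<subseteq> A \<and> (\<pi> \<circ> c) e \<noteq> t}. \<forall>f\<in>{e \<in> B. en e \<subseteq> A \<and> (\<pi> \<circ> c) e \<noteq> t}.
        \<forall>u\<in>en e. \<forall>v\<in>en f. v \<in> reach en {e \<in> B. en e \<subseteq> A \<and> (\<pi> \<circ> c) e \<noteq> t} u" (is "\<forall>t<3. ?P t")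
    proof (intro allI impI)
      fix t :: nat assume "t < 3"
      then obtain s where "s < 3" and s: "{e \<in> B. en e \<subseteq> A \<and> (\<pi> \<circ> c) e \<noteq> t} = {e \<in> B. en e \<subseteq> A \<and> c e \<noteq> s}"
        using ex by blast
      then show "?P t"
        using assms(1) unfolding s kotzig_part_def by blast
    qed
  qed (use assms(1) lt in \<open>auto simp: kotzig_part_def\<close>)
qed

text \<open>\<open>B\<close> is the edge set of the frame, \<open>A\<close> and \<open>A'\<close> are the vertex sets of the K-components. Handshaking
  in the pieces will transfer the evenness of the number of attachments from \<open>A\<close> to \<open>A'\<close>.\<close>

locale framed_graph =
  fixes en :: "'e \<Rightarrow> 'v set" and V :: "'v set" and E B :: "'e set" and A A' :: "'v set"
    and c c' :: "'e \<Rightarrow> nat"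
  assumes finite_V: "finite V" and finite_E: "finite E" and B_subset: "B \<subseteq> E"
    and ends: "\<And>e. e \<in> E \<Longrightarrow> en e \<subseteq> V" and card_ends: "\<And>e. e \<in> E \<Longrightarrow> card (en e) = 2"
    and matching: "\<And>v. v \<in> V \<Longrightarrow> deg en (E - B) v \<le> 1"
    and cycle_vertex: "\<And>v. v \<in> V - A - A' \<Longrightarrow> deg en (E - B) v = 1 \<and> deg en B v = 2"
    and A_subset: "A \<subseteq> V" "A' \<subseteq> V" "A \<inter> A' = {}"
    and closed: "\<And>e. e \<in> B \<Longrightarrow> en e \<subseteq> A \<or> en e \<subseteq> A' \<or> en e \<subseteq> V - A - A'"
    and kotzig: "kotzig_part en B A c" "kotzig_part en B A' c'"
    and even_attachments: "even (card {v \<in> A. deg en (E - B) v = 1})"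
    and even_cycles: "\<And>v. v \<in> V - A - A' \<Longrightarrow> even (card (reach en B v))"
begin

definition M :: "'e set" where "M = E - B"

definition W :: "'v set" where "W = V - A - A'"

definition C_edges :: "'e set" where "C_edges = {e \<in> B. en e \<subseteq> W}"

definition N :: "'e set" where "N = M \<union> C_edges"

abbreviation piece :: "'v \<Rightarrow> 'v set" where "piece \<equiv> reach en N"

text \<open>The colour of any frame edge at \<open>v\<close> serves the purpose: a type \<open>t\<close> different from it
  places \<open>v\<close> on an edge of \<open>R t\<close>.\<close>

definition col :: "'v \<Rightarrow> nat" where
  "col v = (if v \<in> A then c (SOME e. e \<in> B \<and> v \<in> en e \<and> en e \<subseteq> A)
    else c' (SOME e. e \<in> B \<and> v \<in> en e \<and> en e \<subseteq> A'))"

definition att :: "'v set" where "att = {v \<in> A \<union> A'. deg en M v = 1}"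

lemma fin [simp]: "finite M" "finite C_edges" "finite N" "finite B" "finite A" "finite A'" "finite W"
  "finite att" "finite V"
  using finite_E finite_V B_subset A_subset finite_subset
  by (auto simp: M_def C_edges_def N_def W_def att_def intro: finite_subset)

lemma sub: "M \<subseteq> E" "C_edges \<subseteq> B" "N \<subseteq> E" "M \<inter> C_edges = {}" "M \<inter> B = {}"
  using B_subset by (auto simp: M_def C_edges_def N_def)

lemma V_cases: "v \<in> V \<longleftrightarrow> v \<in> A \<or> v \<in> A' \<or> v \<in> W"
  using A_subset by (auto simp: W_def)

lemma disj: "v \<in> A \<Longrightarrow> v \<notin> A'" "v \<in> A \<Longrightarrow> v \<notin> W" "v \<in> A' \<Longrightarrow> v \<notin> W" "v \<in> A' \<Longrightarrow> v \<notin> A"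
  using A_subset by (auto simp: W_def)

lemma B_edge_in:
  assumes "e \<in> B" "v \<in> en e"
  shows "v \<in> A \<Longrightarrow> en e \<subseteq> A" "v \<in> A' \<Longrightarrow> en e \<subseteq> A'" "v \<in> W \<Longrightarrow> en e \<subseteq> W"
  using closed[OF assms(1)] assms(2) disj by (auto simp: W_def)

lemma piece_subset: "v \<in> V \<Longrightarrow> piece v \<subseteq> V"
  using ends sub(3) by (intro reach_subset) blast+

lemma fin_piece: "D \<in> piece ` V \<Longrightarrow> finite D"
  using piece_subset finite_V finite_subset by blast

lemma edge_in_piece:
  assumes "e \<in> N" "v \<in> en e"
  shows "en e \<subseteq> piece v"
  using assms sub(3) card_ends by (intro reach_ends_subset[of N en e v]) auto

lemma deg_M_W: "v \<in> W \<Longrightarrow> deg en M v = 1"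
  using cycle_vertex by (simp add: W_def M_def)

lemma C_edges_at: "v \<in> W \<Longrightarrow> {e \<in> C_edges. v \<in> en e} = {e \<in> B. v \<in> en e}"
  "v \<notin> W \<Longrightarrow> {e \<in> C_edges. v \<in> en e} = {}"
  unfolding C_edges_def using B_edge_in(3) by blast+

text \<open>In the graph of the pieces, attachments have degree 1 and the vertices of C-components have
  degree 3.\<close>

lemma odd_deg_N:
  assumes "v \<in> V"
  shows "odd (deg en N v) \<longleftrightarrow> v \<in> att \<or> v \<in> W"
proof -
  have d: "deg en N v = deg en M v + deg en C_edges v"
    unfolding N_def using sub by (intro deg_Un) auto
  show ?thesis
  proof (cases "v \<in> W")
    case True
    then have "deg en C_edges v = 2"
      using cycle_vertex C_edges_at(1) by (simp add: deg_def W_def)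
    then show ?thesis using True d deg_M_W by simp
  next
    case False
    then have "deg en C_edges v = 0" using C_edges_at(2) by (simp add: deg_def)
    moreover have "deg en M v = 0 \<or> deg en M v = 1"
      using matching[OF assms] by (auto simp: M_def)
    ultimately show ?thesis using d False assms V_cases by (auto simp: att_def)
  qed
qed

lemma reach_B_W: "v \<in> W \<Longrightarrow> reach en B v \<subseteq> W"
  using B_edge_in(3) by (intro reach_subset) blast+

lemma reach_B_piece:
  assumes "v \<in> W"
  shows "reach en B v \<subseteq> piece v"
proof -
  have "reach en B v \<subseteq> W \<inter> piece v"
  proof (rule reach_subset)
    fix e assume e: "e \<in> B" "en e \<inter> (W \<inter> piece v) \<noteq> {}"
    then obtain x where x: "x \<in> en e" "x \<in> W" "x \<in> piece v" by auto
    then have "en e \<subseteq> W" using B_edge_in(3) e by blast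
    moreover then have "e \<in> N" using e by (auto simp: N_def C_edges_def)
    then have "en e \<subseteq> piece x" using edge_in_piece x by blast
    ultimately show "en e \<subseteq> W \<inter> piece v" using reach_eq[OF x(3)] by blast
  qed (use assms in auto)
  then show ?thesis by auto
qed

text \<open>By handshaking in \<open>D\<close>, since the C-components in \<open>D\<close> have an even number of vertices altogether.\<close>

lemma piece_parity:
  assumes "D \<in> piece ` V"
  shows "odd (card (D \<inter> (att \<inter> A))) \<longleftrightarrow> odd (card (D \<inter> (att \<inter> A')))"
proof -
  obtain u where u: "u \<in> V" "D = piece u" using assms by auto
  have DV: "D \<subseteq> V" using piece_subset u by auto
  have [simp]: "finite D" using fin_piece assms by auto
  have clD: "en e \<subseteq> D" if "e \<in> N" "x \<in> en e" "x \<in> D" for e x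
    using edge_in_piece[OF that(1,2)] reach_eq[of x en N u] that u by auto
  have "even (\<Sum>v\<in>D. deg en N v)"
  proof (rule even_sum_deg)
    show "\<And>e. e \<in> N \<Longrightarrow> card (en e) = 2" using card_ends sub by auto
    show "\<And>e. e \<in> N \<Longrightarrow> en e \<inter> D \<noteq> {} \<Longrightarrow> en e \<subseteq> D" using clD by blast
  qed auto
  moreover have "{v \<in> D. odd (deg en N v)} = ((D \<inter> (att \<inter> A)) \<union> (D \<inter> (att \<inter> A'))) \<union> (D \<inter> W)"
    using odd_deg_N DV by (auto simp: att_def)
  moreover have "card (((D \<inter> (att \<inter> A)) \<union> (D \<inter> (att \<inter> A'))) \<union> (D \<inter> W)) =
    card (D \<inter> (att \<inter> A)) + card (D \<inter> (att \<inter> A')) + card (D \<inter> W)"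
    using disj by (subst card_Un_disjoint; (subst card_Un_disjoint)?) auto
  moreover have "even (card (D \<inter> W))"
  proof (rule even_card_Un_classes)
    show "finite B" by simp
    show "\<And>e. e \<in> B \<Longrightarrow> card (en e) = 2" using card_ends B_subset by auto
    fix v assume v: "v \<in> D \<inter> W"
    then have "reach en B v \<subseteq> D \<inter> W"
      using reach_B_W[of v] reach_B_piece[of v] reach_eq[of v en N u] u by auto
    moreover have "even (card (reach en B v))" using even_cycles v by (auto simp: W_def)
    ultimately show "reach en B v \<subseteq> D \<inter> W \<and> even (card (reach en B v))" by blast
  qed auto
  ultimately show ?thesis using odd_sum_card[of D "deg en N"] by simp
qed

lemma A_color: "v \<in> A \<Longrightarrow> \<exists>e\<in>B. v \<in> en e \<and> en e \<subseteq> A \<and> col v = c e"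
proof -
  assume v: "v \<in> A"
  let ?e = "SOME e. e \<in> B \<and> v \<in> en e \<and> en e \<subseteq> A"
  have "\<exists>e. e \<in> B \<and> v \<in> en e \<and> en e \<subseteq> A" using kotzig(1) v by (auto simp: kotzig_part_def)
  from someI_ex[OF this] show ?thesis using v by (intro bexI[of _ ?e]) (auto simp: col_def)
qed

lemma A'_color: "v \<in> A' \<Longrightarrow> \<exists>e\<in>B. v \<in> en e \<and> en e \<subseteq> A' \<and> col v = c' e"
proof -
  assume v: "v \<in> A'"
  let ?e = "SOME e. e \<in> B \<and> v \<in> en e \<and> en e \<subseteq> A'"
  have "\<exists>e. e \<in> B \<and> v \<in> en e \<and> en e \<subseteq> A'" using kotzig(2) v by (auto simp: kotzig_part_def)
  from someI_ex[OF this] show ?thesis using v disj by (intro bexI[of _ ?e]) (auto simp: col_def)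
qed

lemma col_lt: "v \<in> A \<union> A' \<Longrightarrow> col v < 3"
  using A_color[of v] A'_color[of v] kotzig by (auto simp: kotzig_part_def)

lemma odd_color_class:
  assumes "finite S" "odd (card S)" "\<And>v. v \<in> S \<Longrightarrow> h v < (3::nat)"
  shows "\<exists>i<3. odd (card {v \<in> S. h v = i})"
proof -
  have "card S = card {v \<in> S. h v = 0} + card {v \<in> S. h v = 1} + card {v \<in> S. h v = 2}"
    using assms by (intro card_by_three_values) auto
  then have "odd (card {v \<in> S. h v = 0}) \<or> odd (card {v \<in> S. h v = 1}) \<or> odd (card {v \<in> S. h v = 2})"
    using assms(2) by auto
  moreover have "0 < (3::nat)" "1 < (3::nat)" "2 < (3::nat)" by auto
  ultimately show ?thesis by blast
qed

lemma even_by_classes: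
  assumes "U \<subseteq> V"
  shows "odd (card U) \<longleftrightarrow> odd (card {D \<in> piece ` V. odd (card (D \<inter> U))})"
proof -
  have "card U = (\<Sum>D\<in>piece ` V. card (D \<inter> U))" using assms by (intro card_by_classes) auto
  then show ?thesis using odd_sum_card[of "piece ` V" "\<lambda>D. card (D \<inter> U)"] by simp
qed

text \<open>Here \<open>\<pi>\<close> is the permutation of the colours of the second K-component and \<open>z D\<close> the type omitted from
  the piece \<open>D\<close>. Evenness holds both at each K-component, where the contributions of
  the odd pieces cancel, and within each piece, where the two sides have the same
  parities.\<close>

lemma attachment_types:
  obtains \<pi> :: "nat \<Rightarrow> nat" and z :: "'v set \<Rightarrow> nat" and \<tau> :: "'v \<Rightarrow> nat"
  where "bij_betw \<pi> {..<3} {..<3}"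
    and "\<And>D. D \<in> piece ` V \<Longrightarrow> z D < 3"
    and "\<And>v. v \<in> att \<Longrightarrow> \<tau> v < 3 \<and> \<tau> v \<noteq> z (piece v) \<and>
      (v \<in> A \<longrightarrow> \<tau> v \<noteq> col v) \<and> (v \<in> A' \<longrightarrow> \<tau> v \<noteq> \<pi> (col v))"
    and "\<And>t. t < 3 \<Longrightarrow> even (card {v \<in> att \<inter> A. \<tau> v = t})"
    and "\<And>t. t < 3 \<Longrightarrow> even (card {v \<in> att \<inter> A'. \<tau> v = t})"
    and "\<And>D t. D \<in> piece ` V \<Longrightarrow> t < 3 \<Longrightarrow> even (card {v \<in> D \<inter> att. \<tau> v = t})"
proof -
  define S where "S D = D \<inter> (att \<inter> A)" for D
  define S' where "S' D = D \<inter> (att \<inter> A')" for D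
  define I where "I = {D \<in> piece ` V. odd (card (S D))}"
  have finS [simp]: "finite (S D)" "finite (S' D)" for D by (auto simp: S_def S'_def)
  have par: "odd (card (S D)) \<longleftrightarrow> odd (card (S' D))" if "D \<in> piece ` V" for D
    using piece_parity[OF that] by (simp add: S_def S'_def)
  have cl: "col v < 3" if "v \<in> S D \<union> S' D" for v D
    using col_lt that by (auto simp: S_def S'_def)
  have "{v \<in> A. deg en (E - B) v = 1} = att \<inter> A" by (auto simp: att_def M_def)
  then have "even (card (att \<inter> A))" using even_attachments by simp
  then have I: "finite I" "even (card I)"
    using even_by_classes[of "att \<inter> A"] A_subset by (auto simp: I_def S_def)
  have "\<forall>D\<in>I. \<exists>i<3. odd (card {v \<in> S D. col v = i})"
  proof
    fix D assume "D \<in> I"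
    then have "odd (card (S D))" by (auto simp: I_def)
    then show "\<exists>i<3. odd (card {v \<in> S D. col v = i})"
      using odd_color_class[of "S D" col] cl by auto
  qed
  from bchoice[OF this] obtain r
    where r: "\<And>D. D \<in> I \<Longrightarrow> r D < 3" "\<And>D. D \<in> I \<Longrightarrow> odd (card {v \<in> S D. col v = r D})"
    by blast
  have "\<forall>D\<in>I. \<exists>i<3. odd (card {v \<in> S' D. col v = i})"
  proof
    fix D assume "D \<in> I"
    then have "odd (card (S' D))" using par by (auto simp: I_def)
    then show "\<exists>i<3. odd (card {v \<in> S' D. col v = i})"
      using odd_color_class[of "S' D" col] cl by auto
  qed
  from bchoice[OF this] obtain s
    where s: "\<And>D. D \<in> I \<Longrightarrow> s D < 3" "\<And>D. D \<in> I \<Longrightarrow> odd (card {v \<in> S' D. col v = s D})"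
    by blast
  obtain \<pi> f where \<pi>: "bij_betw \<pi> {..<3} {..<3::nat}"
    and f: "\<And>D. D \<in> I \<Longrightarrow> f D < 3 \<and> f D \<noteq> r D \<and> f D \<noteq> \<pi> (s D)"
    and f_even: "\<And>t. t < 3 \<Longrightarrow> even (card {D \<in> I. f D = t})"
    using balanced_types[OF I, of r s] r(1) s(1) by blast
  define h where "h v = (if v \<in> A then col v else \<pi> (col v))" for v
  have h: "h v < 3" if "v \<in> S D \<union> S' D" for v D
    using cl[OF that] \<pi> by (auto simp: h_def bij_betw_def)
  have disS: "S D \<inter> S' D = {}" for D using disj by (auto simp: S_def S'_def)
  have hr: "odd (card {v \<in> S D. h v = r D})" "odd (card {v \<in> S' D. h v = \<pi> (s D)})" if "D \<in> I" for D
  proof -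
    have "{v \<in> S D. h v = r D} = {v \<in> S D. col v = r D}" by (auto simp: S_def h_def)
    then show "odd (card {v \<in> S D. h v = r D})" using r(2)[OF that] by simp
    have "h v = \<pi> (s D) \<longleftrightarrow> col v = s D" if "v \<in> S' D" for v
    proof -
      have "v \<notin> A" using that disj by (auto simp: S'_def)
      then show ?thesis
        using cl[of v D] s(1)[OF \<open>D \<in> I\<close>] that \<pi> by (auto simp: h_def bij_betw_def inj_on_def)
    qed
    then have "{v \<in> S' D. h v = \<pi> (s D)} = {v \<in> S' D. col v = s D}" by auto
    then show "odd (card {v \<in> S' D. h v = \<pi> (s D)})" using s(2)[OF that] by simp
  qed
  have "\<exists>z. \<exists>\<tau>. z < 3 \<and> (\<forall>v\<in>S D \<union> S' D. \<tau> v < 3 \<and> \<tau> v \<noteq> z \<and> \<tau> v \<noteq> h v) \<and>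
    (\<forall>t<3. (odd (card {v \<in> S D. \<tau> v = t}) \<longleftrightarrow> D \<in> I \<and> f D = t) \<and>
      (odd (card {v \<in> S' D. \<tau> v = t}) \<longleftrightarrow> D \<in> I \<and> f D = t))" if D: "D \<in> piece ` V" for D
  proof (cases "D \<in> I")
    case True
    have "odd (card (S D))" "odd (card (S' D))" using True D par[OF D] by (auto simp: I_def)
    then have "\<exists>z<3. \<exists>\<tau>. (\<forall>v\<in>S D \<union> S' D. \<tau> v < 3 \<and> \<tau> v \<noteq> z \<and> \<tau> v \<noteq> h v) \<and>
      (\<forall>t<3. (odd (card {v \<in> S D. \<tau> v = t}) \<longleftrightarrow> t = f D) \<and>
        (odd (card {v \<in> S' D. \<tau> v = t}) \<longleftrightarrow> t = f D))"
      using disS h[of _ D] hr[OF True] f[OF True] by (intro odd_piece_types) auto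
    then show ?thesis using True by (simp add: eq_commute[of "f D"])
  next
    case False
    then have "even (card (S D))" "even (card (S' D))" using D par[OF D] by (auto simp: I_def)
    then show ?thesis using even_piece_types[OF finS disS h, of D] False by simp
  qed
  then have "\<forall>D\<in>piece ` V. \<exists>z. \<exists>\<tau>. z < 3 \<and> (\<forall>v\<in>S D \<union> S' D. \<tau> v < 3 \<and> \<tau> v \<noteq> z \<and> \<tau> v \<noteq> h v) \<and>
    (\<forall>t<3. (odd (card {v \<in> S D. \<tau> v = t}) \<longleftrightarrow> D \<in> I \<and> f D = t) \<and>
      (odd (card {v \<in> S' D. \<tau> v = t}) \<longleftrightarrow> D \<in> I \<and> f D = t))"
    by blast
  from bchoice[OF this] obtain z where "\<forall>D\<in>piece ` V. \<exists>\<tau>. z D < 3 \<and>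
      (\<forall>v\<in>S D \<union> S' D. \<tau> v < 3 \<and> \<tau> v \<noteq> z D \<and> \<tau> v \<noteq> h v) \<and>
    (\<forall>t<3. (odd (card {v \<in> S D. \<tau> v = t}) \<longleftrightarrow> D \<in> I \<and> f D = t) \<and>
      (odd (card {v \<in> S' D. \<tau> v = t}) \<longleftrightarrow> D \<in> I \<and> f D = t))"
    by blast
  from bchoice[OF this] obtain \<sigma> where z: "\<And>D. D \<in> piece ` V \<Longrightarrow> z D < (3::nat)"
    and \<sigma>: "\<And>D v. D \<in> piece ` V \<Longrightarrow> v \<in> S D \<union> S' D \<Longrightarrow> \<sigma> D v < 3 \<and> \<sigma> D v \<noteq> z D \<and> \<sigma> D v \<noteq> h v"
    and \<sigma>_par: "\<And>D t. D \<in> piece ` V \<Longrightarrow> t < 3 \<Longrightarrow> odd (card {v \<in> S D. \<sigma> D v = t}) \<longleftrightarrow> D \<in> I \<and> f D = t"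
      "\<And>D t. D \<in> piece ` V \<Longrightarrow> t < 3 \<Longrightarrow> odd (card {v \<in> S' D. \<sigma> D v = t}) \<longleftrightarrow> D \<in> I \<and> f D = t"
    by blast
  define \<tau> where "\<tau> v = \<sigma> (piece v) v" for v
  have \<tau>_piece: "\<tau> v = \<sigma> D v" if "D \<in> piece ` V" "v \<in> D" for D v
    using that reach_eq[of v en N] by (auto simp: \<tau>_def)
  have \<tau>S: "{v \<in> S D. \<tau> v = t} = {v \<in> S D. \<sigma> D v = t}" "{v \<in> S' D. \<tau> v = t} = {v \<in> S' D. \<sigma> D v = t}"
    if "D \<in> piece ` V" for D t
    using \<tau>_piece[OF that] by (auto simp: S_def S'_def)
  have attV: "att \<subseteq> V" using A_subset by (auto simp: att_def)
  have 1: "\<tau> v < 3 \<and> \<tau> v \<noteq> z (piece v) \<and> (v \<in> A \<longrightarrow> \<tau> v \<noteq> col v) \<and> (v \<in> A' \<longrightarrow> \<tau> v \<noteq> \<pi> (col v))"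
    if v: "v \<in> att" for v
  proof -
    have "v \<in> S (piece v) \<union> S' (piece v)" using v by (auto simp: S_def S'_def att_def)
    moreover have "piece v \<in> piece ` V" using v attV by auto
    ultimately show ?thesis using \<sigma>[of "piece v" v] disj by (auto simp: \<tau>_def h_def)
  qed
  have 2: "even (card {v \<in> att \<inter> A. \<tau> v = t})" if t: "t < 3" for t
  proof -
    have "D \<inter> {v \<in> att \<inter> A. \<tau> v = t} = {v \<in> S D. \<tau> v = t}" for D by (auto simp: S_def)
    then have "odd (card (D \<inter> {v \<in> att \<inter> A. \<tau> v = t})) \<longleftrightarrow> D \<in> I \<and> f D = t" if "D \<in> piece ` V" for D
      using \<sigma>_par(1)[OF that t] \<tau>S(1)[OF that] by (simp only:)
    then have "{D \<in> piece ` V. odd (card (D \<inter> {v \<in> att \<inter> A. \<tau> v = t}))} = {D \<in> I. f D = t}"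
      by (auto simp: I_def)
    then show ?thesis using even_by_classes[of "{v \<in> att \<inter> A. \<tau> v = t}"] attV f_even[OF t] by auto
  qed
  have 3: "even (card {v \<in> att \<inter> A'. \<tau> v = t})" if t: "t < 3" for t
  proof -
    have "D \<inter> {v \<in> att \<inter> A'. \<tau> v = t} = {v \<in> S' D. \<tau> v = t}" for D by (auto simp: S'_def)
    then have "odd (card (D \<inter> {v \<in> att \<inter> A'. \<tau> v = t})) \<longleftrightarrow> D \<in> I \<and> f D = t" if "D \<in> piece ` V" for D
      using \<sigma>_par(2)[OF that t] \<tau>S(2)[OF that] by (simp only:)
    then have "{D \<in> piece ` V. odd (card (D \<inter> {v \<in> att \<inter> A'. \<tau> v = t}))} = {D \<in> I. f D = t}"
      by (auto simp: I_def)
    then show ?thesis using even_by_classes[of "{v \<in> att \<inter> A'. \<tau> v = t}"] attV f_even[OF t] by auto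
  qed
  have 4: "even (card {v \<in> D \<inter> att. \<tau> v = t})" if D: "D \<in> piece ` V" and t: "t < 3" for D t
  proof -
    have "{v \<in> D \<inter> att. \<tau> v = t} = {v \<in> S D. \<tau> v = t} \<union> {v \<in> S' D. \<tau> v = t}"
      by (auto simp: S_def S'_def att_def)
    moreover have "card ({v \<in> S D. \<tau> v = t} \<union> {v \<in> S' D. \<tau> v = t}) =
        card {v \<in> S D. \<tau> v = t} + card {v \<in> S' D. \<tau> v = t}"
      using disS[of D] by (intro card_Un_disjoint) auto
    ultimately show ?thesis using \<sigma>_par[OF D t] \<tau>S[OF D] by simp blast
  qed
  show ?thesis by (rule that) (fact \<pi> z 1 2 3 4)+
qed

lemma M_edge_at:
  assumes "v \<in> V" "deg en M v = 1"
  obtains m where "m \<in> M" "v \<in> en m" "\<And>e. e \<in> M \<Longrightarrow> v \<in> en e \<Longrightarrow> e = m"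
proof -
  obtain m where "{e \<in> M. v \<in> en e} = {m}"
    using assms(2) card_1_singletonE unfolding deg_def by blast
  then show ?thesis using that[of m] by blast
qed

text \<open>An edge of \<open>M\<close> is determined by either of its ends.\<close>

lemma deg_typed:
  assumes "v \<in> V"
  shows "deg en {e \<in> M. P e} v = 1 \<longleftrightarrow> (\<exists>e\<in>M. v \<in> en e \<and> P e)"
proof
  assume "deg en {e \<in> M. P e} v = 1"
  then have "{e \<in> {e \<in> M. P e}. v \<in> en e} \<noteq> {}"
    unfolding deg_def using card_1_singletonE by blast
  then show "\<exists>e\<in>M. v \<in> en e \<and> P e" by auto
next
  assume "\<exists>e\<in>M. v \<in> en e \<and> P e"
  then obtain e where e: "e \<in> M" "v \<in> en e" "P e" by auto
  have "card {e \<in> M. v \<in> en e} \<le> 1" using matching[OF assms] by (simp add: deg_def M_def)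
  moreover have "finite {e \<in> M. v \<in> en e}" by simp
  ultimately have "{e \<in> M. v \<in> en e} = {e}" using e by (intro card_seteq[symmetric]) auto
  then have "{f \<in> {e \<in> M. P e}. v \<in> en f} = {e}" using e by blast
  then show "deg en {e \<in> M. P e} v = 1" by (simp add: deg_def)
qed

lemma deg_M_eq_1: "v \<in> V \<Longrightarrow> deg en M v = 1 \<longleftrightarrow> (\<exists>e\<in>M. v \<in> en e)"
  using deg_typed[of v "\<lambda>_. True"] by simp

text \<open>Let \<open>J\<close> be a \<open>T\<close>-join, inside the pieces, for the attachments that have the first of the two types of
  their piece. The \<open>M\<close>-edges in \<open>J\<close> get the first type and those outside the second. On a C-component
  no vertex has odd degree in \<open>J\<close>, so handshaking shows that an even number of its vertices have
  their \<open>M\<close>-edge in \<open>J\<close>; the remaining ones are even in number because the C-component has an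
  even number of vertices.\<close>

lemma edge_types:
  assumes z: "\<And>D. D \<in> piece ` V \<Longrightarrow> z D < (3::nat)"
    and \<tau>: "\<And>v. v \<in> att \<Longrightarrow> \<tau> v < 3 \<and> \<tau> v \<noteq> z (piece v)"
    and par: "\<And>D t. D \<in> piece ` V \<Longrightarrow> t < 3 \<Longrightarrow> even (card {v \<in> D \<inter> att. \<tau> v = t})"
  obtains ty :: "'e \<Rightarrow> nat"
  where "\<And>e. e \<in> M \<Longrightarrow> ty e < 3"
    and "\<And>v e. v \<in> att \<Longrightarrow> e \<in> M \<Longrightarrow> v \<in> en e \<Longrightarrow> ty e = \<tau> v"
    and "\<And>v e. v \<in> W \<Longrightarrow> e \<in> M \<Longrightarrow> v \<in> en e \<Longrightarrow> ty e \<noteq> z (piece v)"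
    and "\<And>v t. v \<in> W \<Longrightarrow> t < 3 \<Longrightarrow> even (card {x \<in> reach en B v. \<exists>e\<in>M. x \<in> en e \<and> ty e = t})"
proof -
  \<comment> \<open>The two types of a piece.\<close>
  define t1 where "t1 D = (if z D = 0 then 1 else 0::nat)" for D
  define t2 where "t2 D = 3 - z D - t1 D" for D
  have three: "{z D, t1 D, t2 D} = {0, 1, 2}" if "D \<in> piece ` V" for D
    unfolding t2_def by (rule third_value) (use z[OF that] in \<open>auto simp: t1_def\<close>)
  define T where "T = {v \<in> att. \<tau> v = t1 (piece v)}"
  have attV: "att \<subseteq> V" using A_subset by (auto simp: att_def)
  have "\<exists>J\<subseteq>N. \<forall>w. odd (deg en J w) \<longleftrightarrow> w \<in> T"
  proof (rule T_join_exists)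
    fix u assume "u \<in> T"
    then have u: "u \<in> V" using attV by (auto simp: T_def)
    have "T \<inter> piece u = {v \<in> piece u \<inter> att. \<tau> v = t1 (piece u)}"
    proof (rule set_eqI)
      fix v
      show "v \<in> T \<inter> piece u \<longleftrightarrow> v \<in> {v \<in> piece u \<inter> att. \<tau> v = t1 (piece u)}"
      proof (cases "v \<in> piece u")
        case True
        then have "piece v = piece u" by (rule reach_eq)
        then show ?thesis using True by (simp add: T_def)
      qed simp
    qed
    then show "even (card (T \<inter> piece u))" using par[of "piece u" "t1 (piece u)"] u by (simp add: t1_def)
  qed (auto simp: T_def)
  then obtain J where J: "J \<subseteq> N" "\<And>w. odd (deg en J w) \<longleftrightarrow> w \<in> T" by auto
  have [simp]: "finite J" using J(1) by (rule finite_subset) simp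
  \<comment> \<open>The piece of an edge; both ends of the edge lie in it.\<close>
  define pc where "pc e = piece (SOME v. v \<in> en e)" for e
  have pc: "pc e = piece v" if "e \<in> N" "v \<in> en e" for e v
  proof -
    have "(SOME v. v \<in> en e) \<in> en e" using that(2) by (rule someI)
    then have "(SOME v. v \<in> en e) \<in> piece v" using edge_in_piece[OF that] by auto
    then show ?thesis unfolding pc_def using reach_eq by fast
  qed
  define ty where "ty e = (if e \<in> J then t1 (pc e) else t2 (pc e))" for e
  have MN: "M \<subseteq> N" by (auto simp: N_def)
  have pcV: "pc e \<in> piece ` V" if "e \<in> M" for e
  proof -
    have "en e \<noteq> {}" using card_ends[of e] that sub by fastforce
    then obtain v where "v \<in> en e" by auto
    then show ?thesis using pc[of e v] MN that ends[of e] sub by auto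
  qed
  have ty: "ty e < 3" "ty e \<noteq> z (pc e)" if "e \<in> M" for e
    using three_distinct[OF three[OF pcV[OF that]]] by (auto simp: ty_def)
  have 1: "ty e = \<tau> v" if v: "v \<in> att" "e \<in> M" "v \<in> en e" for v e
  proof -
    have vV: "v \<in> V" "v \<notin> W" using v attV disj by (auto simp: att_def)
    obtain m where m: "\<And>e. e \<in> M \<Longrightarrow> v \<in> en e \<Longrightarrow> e = m" using M_edge_at[OF vV(1)] v by (auto simp: att_def)
    have "f = e" if "f \<in> J" "v \<in> en f" for f
    proof -
      have "f \<notin> C_edges" using C_edges_at(2)[OF vV(2)] that by blast
      then have "f \<in> M" using that J(1) by (auto simp: N_def)
      then show ?thesis using m[of f] m[of e] that v by simp
    qed
    then have "{f \<in> J. v \<in> en f} \<subseteq> {e}" by blast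
    then have "{f \<in> J. v \<in> en f} = (if e \<in> J then {e} else {})" using v by (cases "e \<in> J") auto
    then have "odd (deg en J v) \<longleftrightarrow> e \<in> J" by (simp add: deg_def)
    then have "e \<in> J \<longleftrightarrow> \<tau> v = t1 (piece v)" using J(2) v by (simp add: T_def)
    moreover have "\<tau> v = t1 (piece v) \<or> \<tau> v = t2 (piece v)"
      using \<tau>[OF v(1)] three_distinct(7)[OF three[of "piece v"], of "\<tau> v"] vV by auto
    moreover have "pc e = piece v" using pc MN v by auto
    ultimately show ?thesis by (auto simp: ty_def)
  qed
  have 2: "even (card {x \<in> reach en B v. \<exists>e\<in>M. x \<in> en e \<and> ty e = t})" if v: "v \<in> W" and t: "t < 3" for v t
  proof -
    let ?Z = "reach en B v"
    define D where "D = piece v"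
    have D: "D \<in> piece ` V" using v by (auto simp: D_def W_def)
    have ZW: "?Z \<subseteq> W" using reach_B_W[OF v] .
    have ZV: "x \<in> V" if "x \<in> ?Z" for x using that ZW by (auto simp: W_def)
    have finZ [simp]: "finite ?Z" using ZW by (rule finite_subset) simp
    have Zp: "pc e = D" if "e \<in> M" "x \<in> en e" "x \<in> ?Z" for e x
    proof -
      have "x \<in> piece v" using reach_B_piece[OF v] that by auto
      then show ?thesis using pc[of e x] that MN reach_eq[of x en N v] by (auto simp: D_def)
    qed
    define Q where "Q = {x \<in> ?Z. \<exists>e\<in>M. x \<in> en e \<and> e \<in> J}"
    have "even (card Q)"
    proof -
      have "even (\<Sum>x\<in>?Z. deg en (J \<inter> C_edges) x)"
      proof (rule even_sum_deg)
        show "\<And>e. e \<in> J \<inter> C_edges \<Longrightarrow> card (en e) = 2" using card_ends sub B_subset by auto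
        fix e assume e: "e \<in> J \<inter> C_edges" "en e \<inter> ?Z \<noteq> {}"
        then obtain x where x: "x \<in> en e" "x \<in> ?Z" by auto
        show "en e \<subseteq> ?Z"
          using reach_ends_subset[of B en e x v] card_ends B_subset sub e x by auto
      qed auto
      then have "even (card {x \<in> ?Z. odd (deg en (J \<inter> C_edges) x)})" using odd_sum_card[OF finZ] by blast
      moreover have parity: "odd (deg en (J \<inter> C_edges) x) \<longleftrightarrow> (\<exists>e\<in>M. x \<in> en e \<and> e \<in> J)" if x: "x \<in> ?Z" for x
      proof -
        have "x \<notin> T" using ZW x disj by (auto simp: T_def att_def)
        then have "even (deg en J x)" using J(2) by auto
        moreover have J_split: "{e \<in> M. e \<in> J} \<union> (J \<inter> C_edges) = J" using J(1) by (auto simp: N_def)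
        have "deg en ({e \<in> M. e \<in> J} \<union> (J \<inter> C_edges)) x = deg en {e \<in> M. e \<in> J} x + deg en (J \<inter> C_edges) x"
          using sub(4) by (intro deg_Un) auto
        then have "deg en J x = deg en {e \<in> M. e \<in> J} x + deg en (J \<inter> C_edges) x"
          unfolding J_split .
        ultimately have "odd (deg en (J \<inter> C_edges) x) \<longleftrightarrow> odd (deg en {e \<in> M. e \<in> J} x)" by auto
        moreover have "deg en {e \<in> M. e \<in> J} x \<le> deg en M x"
          unfolding deg_def by (intro card_mono) auto
        then have "deg en {e \<in> M. e \<in> J} x = 0 \<or> deg en {e \<in> M. e \<in> J} x = 1"
          using matching[OF ZV[OF x]] unfolding M_def[symmetric] by linarith
        then have "odd (deg en {e \<in> M. e \<in> J} x) \<longleftrightarrow> deg en {e \<in> M. e \<in> J} x = 1" by auto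
        ultimately show ?thesis using deg_typed[OF ZV[OF x], of "\<lambda>e. e \<in> J"] by simp
      qed
      have "{x \<in> ?Z. odd (deg en (J \<inter> C_edges) x)} = Q"
        unfolding Q_def by (rule Collect_cong) (use parity in blast)
      ultimately show ?thesis by simp
    qed
    have edge: "\<exists>m\<in>M. x \<in> en m \<and> (\<forall>e\<in>M. x \<in> en e \<longrightarrow> e = m)" if "x \<in> ?Z" for x
    proof -
      have x: "x \<in> V" "deg en M x = 1" using deg_M_W[of x] that ZV ZW by auto
      obtain m where "m \<in> M" "x \<in> en m" "\<And>e. e \<in> M \<Longrightarrow> x \<in> en e \<Longrightarrow> e = m"
        by (rule M_edge_at[OF x]) blast
      then show ?thesis by blast
    qed
    note d = three_distinct[OF three[OF D]]
    consider "t = z D" | "t = t1 D" | "t = t2 D" using d(7)[of t] t by blast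
    then show ?thesis
    proof cases
      case 1
      have "\<not> (\<exists>e\<in>M. x \<in> en e \<and> ty e = t)" if x: "x \<in> ?Z" for x
      proof
        assume "\<exists>e\<in>M. x \<in> en e \<and> ty e = t"
        then obtain e where e: "e \<in> M" "x \<in> en e" "ty e = t" by blast
        show False using Zp[OF e(1,2) x] e(3) 1 d(1,2) by (simp add: ty_def split: if_splits)
      qed
      then have "{x \<in> ?Z. \<exists>e\<in>M. x \<in> en e \<and> ty e = t} = {}" by blast
      then show ?thesis by (simp only: card.empty even_zero)
    next
      case 2
      have "ty e = t \<longleftrightarrow> e \<in> J" if "e \<in> M" "x \<in> en e" "x \<in> ?Z" for e x
        using Zp[OF that] 2 d(3) by (simp add: ty_def)
      then have "{x \<in> ?Z. \<exists>e\<in>M. x \<in> en e \<and> ty e = t} = Q"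
        unfolding Q_def by blast
      then show ?thesis using \<open>even (card Q)\<close> by simp
    next
      case 3
      have "x \<in> {x \<in> ?Z. \<exists>e\<in>M. x \<in> en e \<and> ty e = t} \<longleftrightarrow> x \<in> ?Z - Q" for x
      proof (cases "x \<in> ?Z")
        case True
        obtain m where m: "m \<in> M" "x \<in> en m" "\<forall>e\<in>M. x \<in> en e \<longrightarrow> e = m" using edge[OF True] by blast
        have "ty m = t \<longleftrightarrow> m \<notin> J" using Zp[OF m(1,2) True] 3 d(3) by (simp add: ty_def)
        then show ?thesis using m True unfolding Q_def by blast
      qed simp
      then have "{x \<in> ?Z. \<exists>e\<in>M. x \<in> en e \<and> ty e = t} = ?Z - Q" by blast
      moreover have "card (?Z - Q) = card ?Z - card Q"
        by (intro card_Diff_subset) (auto simp: Q_def)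
      moreover have "even (card ?Z)" using even_cycles v by (simp add: W_def)
      ultimately show ?thesis using \<open>even (card Q)\<close> by simp
    qed
  qed
  have 3: "ty e \<noteq> z (piece v)" if "v \<in> W" "e \<in> M" "v \<in> en e" for v e
    using ty(2)[OF that(2)] pc[of e v] that MN by auto
  show ?thesis by (rule that) (fact ty(1) 1 3 2)+
qed

text \<open>The classes of \<open>R t\<close> that contain an end of an edge of type \<open>t\<close> are the two-coloured part of a
  K-component or a whole C-component, and on both the preceding types occur evenly.\<close>

lemma six_even_sets_of_frame:
  "\<exists>X. (\<forall>i<6. X i \<subseteq> E \<and> (\<forall>v. even (deg en (X i) v))) \<and>
    (\<forall>e\<in>E. card {i. i < (6::nat) \<and> e \<in> X i} = 2)"
proof -
  obtain \<pi> z \<tau> where \<pi>: "bij_betw \<pi> {..<3} {..<3::nat}"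
    and z: "\<And>D. D \<in> piece ` V \<Longrightarrow> z D < (3::nat)"
    and \<tau>: "\<And>v. v \<in> att \<Longrightarrow> \<tau> v < 3 \<and> \<tau> v \<noteq> z (piece v) \<and> (v \<in> A \<longrightarrow> \<tau> v \<noteq> col v) \<and> (v \<in> A' \<longrightarrow> \<tau> v \<noteq> \<pi> (col v))"
    and \<tau>A: "\<And>t. t < 3 \<Longrightarrow> even (card {v \<in> att \<inter> A. \<tau> v = t})"
    and \<tau>A': "\<And>t. t < 3 \<Longrightarrow> even (card {v \<in> att \<inter> A'. \<tau> v = t})"
    and \<tau>D: "\<And>D t. D \<in> piece ` V \<Longrightarrow> t < 3 \<Longrightarrow> even (card {v \<in> D \<inter> att. \<tau> v = t})"
    by (rule attachment_types) (rule that; (assumption | simp only:))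
  have \<tau>z: "\<tau> v < 3 \<and> \<tau> v \<noteq> z (piece v)" if "v \<in> att" for v using \<tau>[OF that] by simp
  obtain ty where ty: "\<And>e. e \<in> M \<Longrightarrow> ty e < 3"
    and ty_att: "\<And>v e. v \<in> att \<Longrightarrow> e \<in> M \<Longrightarrow> v \<in> en e \<Longrightarrow> ty e = \<tau> v"
    and ty_W: "\<And>v e. v \<in> W \<Longrightarrow> e \<in> M \<Longrightarrow> v \<in> en e \<Longrightarrow> ty e \<noteq> z (piece v)"
    and ty_cycle: "\<And>v t. v \<in> W \<Longrightarrow> t < 3 \<Longrightarrow> even (card {x \<in> reach en B v. \<exists>e\<in>M. x \<in> en e \<and> ty e = t})"
    by (rule edge_types[of z \<tau>])
      ((rule z \<tau>z \<tau>D; assumption)+, (rule that; (assumption | simp only:)))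
  define k' where "k' = \<pi> \<circ> c'"
  have kotzig': "kotzig_part en B A' k'"
    unfolding k'_def using kotzig(2) \<pi> by (rule kotzig_part_permute)
  define pc where "pc e = piece (SOME v. v \<in> en e)" for e
  have CN: "C_edges \<subseteq> N" by (auto simp: N_def)
  have pc: "pc e = piece v" if "e \<in> C_edges" "v \<in> en e" for e v
  proof -
    have "(SOME v. v \<in> en e) \<in> en e" using that(2) by (rule someI)
    then have "(SOME v. v \<in> en e) \<in> piece v" using edge_in_piece[of e v] that CN by auto
    then show ?thesis unfolding pc_def using reach_eq by fast
  qed
  define RA where "RA t = {e \<in> B. en e \<subseteq> A \<and> c e \<noteq> t}" for t
  define RA' where "RA' t = {e \<in> B. en e \<subseteq> A' \<and> k' e \<noteq> t}" for t
  define RC where "RC t = {e \<in> C_edges. z (pc e) \<noteq> t}" for t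
  define R where "R t = RA t \<union> RA' t \<union> RC t" for t
  have RB: "R t \<subseteq> B" for t by (auto simp: R_def RA_def RA'_def RC_def C_edges_def)
  have ne: "en e \<noteq> {}" if "e \<in> B" for e
    using card_ends[of e] B_subset that by (metis card.empty subsetD zero_neq_numeral)
  have fin_R [simp]: "finite (RA t)" "finite (RA' t)" "finite (RC t)" for t
    by (auto simp: RA_def RA'_def RC_def)
  have M_typed: "deg en {e \<in> E - B. ty e = t} v = 1 \<longleftrightarrow> (\<exists>e\<in>M. v \<in> en e \<and> ty e = t)" if "v \<in> V" for v t
    using deg_typed[OF that, of "\<lambda>e. ty e = t"] by (simp add: M_def)
  have att_typed: "(\<exists>e\<in>M. v \<in> en e \<and> ty e = t) \<longleftrightarrow> v \<in> att \<and> \<tau> v = t" if "v \<in> A \<union> A'" for v t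
  proof
    assume "\<exists>e\<in>M. v \<in> en e \<and> ty e = t"
    then obtain e where e: "e \<in> M" "v \<in> en e" "ty e = t" by blast
    moreover then have "v \<in> att" using that deg_M_eq_1[of v] V_cases by (auto simp: att_def)
    ultimately show "v \<in> att \<and> \<tau> v = t" using ty_att by auto
  next
    assume "v \<in> att \<and> \<tau> v = t"
    moreover then obtain e where "e \<in> M" "v \<in> en e"
      using deg_M_eq_1[of v] V_cases by (auto simp: att_def)
    ultimately show "\<exists>e\<in>M. v \<in> en e \<and> ty e = t" using ty_att by auto
  qed
  show ?thesis
  proof (rule six_even_sets[where B = B and R = R and ty = ty and V = V])
    show "finite E" "finite V" "B \<subseteq> E" "\<And>e. e \<in> E \<Longrightarrow> en e \<subseteq> V"
      using finite_E finite_V B_subset ends by auto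
    show "deg en (E - B) v \<le> 1" for v
    proof (cases "v \<in> V")
      case False
      then have "{e \<in> E - B. v \<in> en e} = {}" using ends by blast
      then show ?thesis by (simp only: deg_def card.empty)
    qed (rule matching)
    show "\<And>e. e \<in> E - B \<Longrightarrow> ty e < 3" using ty by (simp add: M_def)
    show "\<And>t. R t \<subseteq> B" by (rule RB)
  next
    fix t :: nat and v assume t: "t < 3"
    have "even (deg en (RA t) v)" "even (deg en (RA' t) v)"
      using kotzig(1) kotzig' t by (simp_all add: kotzig_part_def RA_def RA'_def)
    moreover have "even (deg en (RC t) v)"
    proof (cases "v \<in> W \<and> z (piece v) \<noteq> t")
      case True
      then have "{e \<in> RC t. v \<in> en e} = {e \<in> C_edges. v \<in> en e}"
        using pc[of _ v] by (auto simp: RC_def)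
      then have "{e \<in> RC t. v \<in> en e} = {e \<in> B. v \<in> en e}"
        using C_edges_at(1)[of v] True by simp
      then have "deg en (RC t) v = 2" using cycle_vertex[of v] True by (simp add: deg_def W_def)
      then show ?thesis by simp
    next
      case False
      have "\<not> (e \<in> RC t \<and> v \<in> en e)" for e
      proof
        assume e: "e \<in> RC t \<and> v \<in> en e"
        then have "e \<in> C_edges" "z (pc e) \<noteq> t" by (auto simp: RC_def)
        moreover from this have "v \<in> W" using C_edges_at(2)[of v] e by blast
        ultimately show False using False pc[of e v] e by simp
      qed
      then have "{e \<in> RC t. v \<in> en e} = {}" by blast
      then show ?thesis by (simp only: deg_def card.empty even_zero)
    qed
    moreover have "deg en (R t) v = deg en (RA t) v + deg en (RA' t) v + deg en (RC t) v"
    proof -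
      have "RA t \<inter> RA' t = {}" "(RA t \<union> RA' t) \<inter> RC t = {}"
        using ne disj by (fastforce simp: RA_def RA'_def RC_def C_edges_def)+
      then show ?thesis unfolding R_def by (simp add: deg_Un)
    qed
    ultimately show "even (deg en (R t) v)" by simp
  next
    fix e assume e: "e \<in> B"
    have two: "card {t. t < 3 \<and> e \<in> R t} = 2" if "\<And>t. e \<in> R t \<longleftrightarrow> t \<noteq> x" "x < 3" for x
    proof -
      have "{t. t < 3 \<and> e \<in> R t} = {..<3} - {x}" using that(1) by auto
      then show ?thesis using that(2) by simp
    qed
    have "en e \<subseteq> A \<or> en e \<subseteq> A' \<or> en e \<subseteq> W" using closed[OF e] by (simp add: W_def)
    moreover obtain v where v: "v \<in> en e" using ne[OF e] by auto
    ultimately consider "en e \<subseteq> A" "\<not> en e \<subseteq> A'" "\<not> en e \<subseteq> W" | "\<not> en e \<subseteq> A" "en e \<subseteq> A'" "\<not> en e \<subseteq> W"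
      | "\<not> en e \<subseteq> A" "\<not> en e \<subseteq> A'" "en e \<subseteq> W"
      using disj by blast
    then show "card {t. t < 3 \<and> e \<in> R t} = 2"
    proof cases
      case 1
      then show ?thesis using e kotzig(1)
        by (intro two[of "c e"]) (auto simp: R_def RA_def RA'_def RC_def C_edges_def kotzig_part_def)
    next
      case 2
      then show ?thesis using e kotzig'
        by (intro two[of "k' e"]) (auto simp: R_def RA_def RA'_def RC_def C_edges_def kotzig_part_def)
    next
      case 3
      then have "v \<in> V" "e \<in> C_edges" using v e by (auto simp: W_def C_edges_def)
      then have "z (pc e) < 3" using z pc[of e v] v by auto
      then show ?thesis using 3 e
        by (intro two[of "z (pc e)"]) (auto simp: R_def RA_def RA'_def RC_def C_edges_def)
    qed
  next
    fix t :: nat and u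
    assume t: "t < 3" and u: "u \<in> V" and du: "deg en {e \<in> E - B. ty e = t} u = 1"
    have RV: "reach en (R t) u \<subseteq> V"
      using u RB B_subset ends by (intro reach_subset) blast+
    then have eq: "{v \<in> reach en (R t) u. deg en {e \<in> E - B. ty e = t} v = 1} =
        {v \<in> reach en (R t) u. \<exists>e\<in>M. v \<in> en e \<and> ty e = t}"
      using M_typed by blast
    have ute: "\<exists>e\<in>M. u \<in> en e \<and> ty e = t" using du M_typed[OF u] by blast
    consider "u \<in> A" | "u \<in> A'" | "u \<in> W" using u V_cases by blast
    then have "even (card {v \<in> reach en (R t) u. \<exists>e\<in>M. v \<in> en e \<and> ty e = t})"
    proof cases
      case 1
      have into: "\<exists>e\<in>RA t. v \<in> en e" if "v \<in> A" "v \<in> att" "\<tau> v = t" for v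
        using A_color[OF that(1)] \<tau>[OF that(2)] that by (auto simp: RA_def)
      have "v \<in> reach en (RA t) u" if v: "v \<in> A" "v \<in> att" "\<tau> v = t" for v
      proof -
        obtain f where "f \<in> RA t" "v \<in> en f" using into[OF v] by blast
        moreover obtain e where "e \<in> RA t" "u \<in> en e" using into[of u] 1 ute att_typed[of u] by blast
        ultimately show ?thesis using kotzig_part_connected[OF kotzig(1) t] unfolding RA_def by blast
      qed
      then have "v \<in> reach en (R t) u" if "v \<in> A" "v \<in> att" "\<tau> v = t" for v
        using reach_mono[of "RA t" "R t" v en u] that by (auto simp: R_def)
      moreover have "reach en (R t) u \<subseteq> A"
        using 1 RB B_edge_in(1) by (intro reach_subset) blast+
      ultimately have "{v \<in> reach en (R t) u. \<exists>e\<in>M. v \<in> en e \<and> ty e = t} = {v \<in> att \<inter> A. \<tau> v = t}"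
        using att_typed by blast
      then show ?thesis using \<tau>A[OF t] by simp
    next
      case 2
      have into: "\<exists>e\<in>RA' t. v \<in> en e" if "v \<in> A'" "v \<in> att" "\<tau> v = t" for v
        using A'_color[OF that(1)] \<tau>[OF that(2)] that by (auto simp: RA'_def k'_def)
      have "v \<in> reach en (RA' t) u" if v: "v \<in> A'" "v \<in> att" "\<tau> v = t" for v
      proof -
        obtain f where "f \<in> RA' t" "v \<in> en f" using into[OF v] by blast
        moreover obtain e where "e \<in> RA' t" "u \<in> en e" using into[of u] 2 ute att_typed[of u] by blast
        ultimately show ?thesis using kotzig_part_connected[OF kotzig' t] unfolding RA'_def by blast
      qed
      then have "v \<in> reach en (R t) u" if "v \<in> A'" "v \<in> att" "\<tau> v = t" for v
        using reach_mono[of "RA' t" "R t" v en u] that by (auto simp: R_def)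
      moreover have "reach en (R t) u \<subseteq> A'"
        using 2 RB B_edge_in(2) by (intro reach_subset) blast+
      ultimately have "{v \<in> reach en (R t) u. \<exists>e\<in>M. v \<in> en e \<and> ty e = t} = {v \<in> att \<inter> A'. \<tau> v = t}"
        using att_typed by blast
      then show ?thesis using \<tau>A'[OF t] by simp
    next
      case 3
      have zt: "z (piece u) \<noteq> t" using ute ty_W[OF 3] by blast
      have sub1: "reach en (R t) u \<subseteq> reach en B u" by (rule subsetI) (rule reach_mono[OF RB])
      have "reach en B u \<subseteq> reach en (R t) u"
      proof (rule reach_subset)
        fix e assume e: "e \<in> B" "en e \<inter> reach en (R t) u \<noteq> {}"
        then obtain x where x: "x \<in> en e" "x \<in> reach en (R t) u" by auto
        then have "x \<in> reach en B u" using sub1 by auto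
        then have xW: "x \<in> W" "x \<in> piece u" using reach_B_W[OF 3] reach_B_piece[OF 3] by auto
        then have "e \<in> C_edges" using B_edge_in(3)[OF e(1) x(1)] e by (auto simp: C_edges_def)
        moreover have "pc e = piece u" using pc[OF \<open>e \<in> C_edges\<close> x(1)] reach_eq[OF xW(2)] by simp
        ultimately have "e \<in> R t" using zt by (auto simp: R_def RC_def)
        then show "en e \<subseteq> reach en (R t) u"
          using reach_ends_subset[of "R t" en e x u] RB B_subset card_ends x by auto
      qed simp
      then have "reach en (R t) u = reach en B u" using sub1 by blast
      then show ?thesis using ty_cycle[OF 3 t] by simp
    qed
    then show "even (card {v \<in> reach en (R t) u. deg en {e \<in> E - B. ty e = t} v = 1})"
      unfolding eq .
  qed
qed

end

section \<open>Cycle double covers from even sets\<close>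

lemma adjacency_eq_link: "adjacency G = link (ends G) (edges G)"
  by (simp add: adjacency_def link_def)

lemma degree_eq_deg: "degree G v = deg (ends G) (edges G) v"
  by (simp add: degree_def deg_def)

text \<open>The connected component of \<open>v\<close> in the subgraph with edge set \<open>X\<close>.\<close>

definition class_graph :: "('e \<Rightarrow> 'v set) \<Rightarrow> 'e set \<Rightarrow> 'v \<Rightarrow> ('v, 'e) mgraph" where
  "class_graph en X v =
     \<lparr>verts = reach en X v, edges = {e \<in> X. en e \<subseteq> reach en X v}, ends = en\<rparr>"

lemma class_graph_eq: "w \<in> reach en X v \<Longrightarrow> class_graph en X w = class_graph en X v"
  using reach_eq[of w en X v] by (simp add: class_graph_def)

lemma class_graph_connected: "connected (class_graph en X v)"
proof -
  let ?X = "{e \<in> X. en e \<subseteq> reach en X v}"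
  have *: "w \<in> reach en ?X v" if "w \<in> reach en X v" for w
  proof -
    have "(v, w) \<in> (link en X)\<^sup>*" using that by (simp add: reach_def)
    then show ?thesis
    proof (induction rule: rtrancl_induct)
      case (step x y)
      obtain e where e: "e \<in> X" "en e = {x, y}" using step.hyps by (auto simp: link_def)
      have "x \<in> reach en X v" "y \<in> reach en X v"
        using step.hyps by (auto simp: reach_def intro: rtrancl_into_rtrancl)
      then have "e \<in> ?X" using e by auto
      then have "y \<in> reach en ?X x" using e(2) by (rule reach_edge)
      then show ?case by (rule reach_trans[OF step.IH])
    qed simp
  qed
  have "w \<in> reach en ?X u" if "u \<in> reach en X v" "w \<in> reach en X v" for u w
    by (rule reach_trans[OF reach_sym[OF *[OF that(1)]] *[OF that(2)]])
  then show ?thesis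
    unfolding connected_def adjacency_eq_link class_graph_def
    using reach_refl[of v en X] by (auto simp: reach_def)
qed

lemma subgraph_class_graph:
  assumes "multigraph G" "X \<subseteq> edges G" "v \<in> verts G"
  shows "subgraph (class_graph (ends G) X v) G"
proof -
  have "reach (ends G) X v \<subseteq> verts G"
    using assms by (intro reach_subset) (auto simp: multigraph_def)
  then show ?thesis
    using assms finite_subset unfolding subgraph_def multigraph_def class_graph_def
    by (auto intro: finite_subset)
qed

lemma class_graph_edges_at:
  assumes "\<forall>e\<in>X. card (en e) = 2" "w \<in> reach en X v"
  shows "{e \<in> edges (class_graph en X v). w \<in> en e} = {e \<in> X. w \<in> en e}"
  using reach_ends_subset[OF assms(1) _ _ assms(2)] by (auto simp: class_graph_def)

lemma reach_incident:
  assumes "w \<in> reach en X v" "e \<in> X" "v \<in> en e"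
  shows "\<exists>f\<in>X. w \<in> en f"
proof -
  have "(v, w) \<in> (link en X)\<^sup>*" using assms by (simp add: reach_def)
  then show ?thesis
    by (cases rule: rtranclE) (use assms in \<open>auto simp: link_def\<close>)
qed

text \<open>In a cubic graph, an even degree other than 0 is 2.\<close>

lemma cycle_class_graph:
  assumes "cubic G" "X \<subseteq> edges G" and even: "\<And>w. w \<in> verts G \<Longrightarrow> even (deg (ends G) X w)"
    and "e \<in> X" "v \<in> ends G e"
  shows "cycle_of (class_graph (ends G) X v) G"
proof -
  have G: "multigraph G" using assms(1) by (simp add: cubic_def)
  have v: "v \<in> verts G" using G assms(2,4,5) by (auto simp: multigraph_def)
  have c2: "\<forall>e\<in>X. card (ends G e) = 2" using G assms(2) by (auto simp: multigraph_def)
  note sub = subgraph_class_graph[OF G assms(2) v]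
  have "degree (class_graph (ends G) X v) w = 2" if w: "w \<in> verts (class_graph (ends G) X v)" for w
  proof -
    have wG: "w \<in> verts G" using sub w by (auto simp: subgraph_def)
    have wr: "w \<in> reach (ends G) X v" using w by (simp add: class_graph_def)
    have "degree (class_graph (ends G) X v) w = deg (ends G) X w"
      using class_graph_edges_at[OF c2 wr] by (simp add: degree_def deg_def class_graph_def)
    moreover have fin: "finite (edges G)" using G by (simp add: multigraph_def)
    have "deg (ends G) X w \<le> degree G w"
      unfolding deg_def degree_def using fin assms(2) by (intro card_mono) auto
    then have "deg (ends G) X w \<le> 3" using assms(1) wG by (simp add: cubic_def regular_def)
    moreover have "deg (ends G) X w \<noteq> 0"
    proof -
      obtain f where "f \<in> X" "w \<in> ends G f" using reach_incident[OF wr assms(4,5)] by blast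
      moreover have "finite X" using fin assms(2) finite_subset by blast
      ultimately show ?thesis by (auto simp: deg_def)
    qed
    moreover have "even (deg (ends G) X w)" using even[OF wG] .
    moreover have "n = 2" if "n \<le> 3" "n \<noteq> 0" "even n" for n :: nat
    proof -
      have "n = 0 \<or> n = 1 \<or> n = 2 \<or> n = 3" using that(1) by auto
      then show ?thesis using that by auto
    qed
    ultimately show ?thesis by simp
  qed
  then show ?thesis
    using sub class_graph_connected by (auto simp: cycle_of_def cycle_def regular_def subgraph_def)
qed

text \<open>The cycles are the components of the even sets. They are distinct for distinct
  even sets: if a cycle arose from two of them, then at each of its vertices the third edge would
  lie in a further even set, which would contain a second edge at that vertex, and this edge of
  the cycle would be covered three times.\<close>

lemma even_sets_double_cover:
  fixes G :: "('v, 'e) mgraph"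
  assumes G: "cubic G" and X: "\<And>i. i < k \<Longrightarrow> X i \<subseteq> edges G"
    and even: "\<And>i v. i < k \<Longrightarrow> v \<in> verts G \<Longrightarrow> even (deg (ends G) (X i) v)"
    and twice: "\<And>e. e \<in> edges G \<Longrightarrow> card {i. i < k \<and> e \<in> X i} = 2"
  shows "\<exists>S. k_cycle_double_cover k S G"
proof -
  define cl where "cl i = class_graph (ends G) (X i)" for i
  define P where "P i = {cl i v | v. \<exists>e\<in>X i. v \<in> ends G e}" for i
  have mG: "multigraph G" using G by (simp add: cubic_def)
  have ends_cl [simp]: "ends (cl i v) = ends G" for i v by (simp add: cl_def class_graph_def)
  have c2: "\<forall>e\<in>X i. card (ends G e) = 2" if "i < k" for i
    using X[OF that] mG by (auto simp: multigraph_def)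
  have cyc: "cycle_of C G" if "i < k" "C \<in> P i" for i C
    using that cycle_class_graph[OF G X[OF that(1)] even[OF that(1)]] by (auto simp: P_def cl_def)
  have sub: "e \<in> X i" if "C \<in> P i" "e \<in> edges C" for C i e
    using that by (auto simp: P_def cl_def class_graph_def)
  have the_cl: "C = cl i x" if C: "C \<in> P i" "e \<in> edges C" "x \<in> ends G e" for C i e x
  proof -
    obtain v where v: "C = cl i v" using C(1) by (auto simp: P_def)
    then have "x \<in> reach (ends G) (X i) v" using C by (auto simp: cl_def class_graph_def)
    then show ?thesis using v class_graph_eq[of x "ends G" "X i" v] by (simp add: cl_def)
  qed
  have in_P: "cl i x \<in> P i" "e \<in> edges (cl i x)" if "i < k" "e \<in> X i" "x \<in> ends G e" for i e x
  proof -
    show "cl i x \<in> P i" using that by (auto simp: P_def)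
    show "e \<in> edges (cl i x)"
      using reach_ends_subset[OF c2[OF that(1)] that(2,3), of x] that by (simp add: cl_def class_graph_def)
  qed
  have at: "{e \<in> X i. x \<in> ends G e} = {e \<in> edges C. x \<in> ends G e}"
    if "i < k" "C \<in> P i" "f \<in> edges C" "x \<in> ends G f" for i C f x
    using the_cl[OF that(2-4)] class_graph_edges_at[OF c2[OF that(1)], of x x] by (simp add: cl_def)
  have disj: "P i \<inter> P j = {}" if ij: "i < k" "j < k" "i \<noteq> j" for i j
  proof (rule ccontr)
    assume "P i \<inter> P j \<noteq> {}"
    then obtain C where C: "C \<in> P i" "C \<in> P j" by auto
    obtain x e where x: "C = cl i x" "e \<in> X i" "x \<in> ends G e" using C(1) by (auto simp: P_def)
    have e: "e \<in> edges C" using in_P(2)[OF ij(1) x(2,3)] x(1) by simp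
    have xG: "x \<in> verts G" using x X[OF ij(1)] mG by (auto simp: multigraph_def)
    define S where "S = {e \<in> edges C. x \<in> ends G e}"
    have Si: "{e \<in> X i. x \<in> ends G e} = S" and Sj: "{e \<in> X j. x \<in> ends G e} = S"
      using at[OF ij(1) C(1) e x(3)] at[OF ij(2) C(2) e x(3)] by (simp_all add: S_def)
    let ?A = "{e \<in> edges G. x \<in> ends G e}"
    have finA: "finite ?A" using mG by (simp add: multigraph_def)
    have cA: "card ?A = 3" using G xG by (simp add: cubic_def regular_def degree_def)
    have SA: "S \<subseteq> ?A" using Si X[OF ij(1)] by auto
    have xC: "x \<in> verts C" using x(1) by (simp add: cl_def class_graph_def)
    have "card S = 2"
      using cyc[OF ij(1) C(1)] xC by (auto simp: S_def cycle_of_def cycle_def regular_def degree_def subgraph_def)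
    then have "S \<noteq> ?A" using cA by auto
    then obtain g where g: "g \<in> ?A" "g \<notin> S" using SA by blast
    have "{i. i < k \<and> g \<in> X i} \<noteq> {}" using twice[of g] g by force
    then obtain l where l: "l < k" "g \<in> X l" by blast
    then have lij: "l \<noteq> i" "l \<noteq> j" using g Si Sj by auto
    let ?L = "{e \<in> X l. x \<in> ends G e}"
    have "?L \<noteq> {g}" using even[OF l(1) xG] by (auto simp: deg_def)
    then obtain h where h: "h \<in> ?L" "h \<noteq> g" using l g by blast
    \<comment> \<open>The even set \<open>X l\<close> has a second edge \<open>h\<close> at \<open>x\<close>, and only \<open>g\<close> is outside the cycle.\<close>
    have "card (?A - S) = 1"
      using card_Diff_subset[of S ?A] SA finite_subset[OF SA finA] cA \<open>card S = 2\<close> by simp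
    then obtain g' where g': "?A - S = {g'}" by (rule card_1_singletonE)
    have "h \<in> S"
    proof (rule ccontr)
      assume "h \<notin> S"
      moreover have "h \<in> ?A" using h(1) X[OF l(1)] by auto
      ultimately have "h \<in> ?A - S" "g \<in> ?A - S" using g by auto
      then show False using h(2) unfolding g' by simp
    qed
    then have hX: "h \<in> X i" "h \<in> X j" "h \<in> edges G" using Si Sj SA by auto
    have "{i, j, l} \<subseteq> {i. i < k \<and> h \<in> X i}" using ij(1,2) l(1) hX(1,2) h(1) by simp
    then have "card {i, j, l} \<le> card {i. i < k \<and> h \<in> X i}" by (intro card_mono) auto
    then have "card {i, j, l} \<le> 2" using twice[OF hX(3)] by simp
    then show False using lij ij(3) by simp
  qed
  have "card {C \<in> (\<Union>i<k. P i). e \<in> edges C} = 2" if e: "e \<in> edges G" for e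
  proof -
    have "ends G e \<noteq> {}" using mG e by (auto simp: multigraph_def)
    then obtain x where x: "x \<in> ends G e" by auto
    have "{C \<in> (\<Union>i<k. P i). e \<in> edges C} = (\<lambda>i. cl i x) ` {i. i < k \<and> e \<in> X i}"
    proof (intro set_eqI iffI)
      fix C assume "C \<in> {C \<in> (\<Union>i<k. P i). e \<in> edges C}"
      then obtain i where "i < k" "C \<in> P i" "e \<in> edges C" by auto
      then show "C \<in> (\<lambda>i. cl i x) ` {i. i < k \<and> e \<in> X i}" using the_cl[of C i e x] sub[of C i e] x by auto
    next
      fix C assume "C \<in> (\<lambda>i. cl i x) ` {i. i < k \<and> e \<in> X i}"
      then show "C \<in> {C \<in> (\<Union>i<k. P i). e \<in> edges C}" using in_P x by auto
    qed
    moreover have "inj_on (\<lambda>i. cl i x) {i. i < k \<and> e \<in> X i}"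
    proof (rule inj_onI, rule ccontr)
      fix i j assume "i \<in> {i. i < k \<and> e \<in> X i}" "j \<in> {i. i < k \<and> e \<in> X i}" "cl i x = cl j x" "i \<noteq> j"
      then show False using disj[of i j] in_P(1)[of i e x] in_P(1)[of j e x] x by auto
    qed
    ultimately show ?thesis using twice[OF e] by (simp add: card_image)
  qed
  then have "cycle_double_cover (\<Union>i<k. P i) G"
    using cyc by (auto simp: cycle_double_cover_def)
  moreover have "pairwise (\<lambda>C D. edges C \<inter> edges D = {}) (P i)" if "i < k" for i
  proof (rule pairwiseI, rule ccontr)
    fix C D assume CD: "C \<in> P i" "D \<in> P i" "C \<noteq> D" "edges C \<inter> edges D \<noteq> {}"
    then obtain e where e: "e \<in> edges C" "e \<in> edges D" by auto
    have "e \<in> edges G" using sub[OF CD(1) e(1)] X[OF that] by auto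
    then have "ends G e \<noteq> {}" using mG by (auto simp: multigraph_def)
    then obtain x where "x \<in> ends G e" by auto
    then show False using the_cl[OF CD(1) e(1)] the_cl[OF CD(2) e(2)] CD(3) by auto
  qed
  ultimately show ?thesis
    unfolding k_cycle_double_cover_def
    using disj by (intro exI[of _ "\<Union>i<k. P i"] conjI exI[of _ P]) (auto simp: disjoint_family_on_def)
qed

section \<open>Subdivisions of Kotzig graphs\<close>

lemma path_in_ConsE:
  assumes "path_in G (a # vs) (e # es)"
  shows "path_in G vs es" "ends G e = {a, hd vs}" "a \<notin> set vs" "vs \<noteq> []"
proof -
  have l: "length vs = Suc (length es)" and i: "\<forall>i<Suc (length es). ends G ((e # es) ! i) = {(a # vs) ! i, (a # vs) ! Suc i}"
    using assms by (auto simp: path_in_def)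
  show ne: "vs \<noteq> []" using l by auto
  show "ends G e = {a, hd vs}" using i[rule_format, of 0] ne by (simp add: hd_conv_nth)
  show "a \<notin> set vs" using assms by (simp add: path_in_def)
  have "\<forall>i<length es. ends G (es ! i) = {vs ! i, vs ! Suc i}"
    using i by auto
  then show "path_in G vs es" using assms l by (simp add: path_in_def)
qed

lemma path_in_induct [consumes 1, case_names Nil Cons]:
  assumes "path_in G vs es"
    and "\<And>a. P [a] []"
    and "\<And>a vs e es. path_in G vs es \<Longrightarrow> P vs es \<Longrightarrow> ends G e = {a, hd vs} \<Longrightarrow> a \<notin> set vs \<Longrightarrow> vs \<noteq> [] \<Longrightarrow> P (a # vs) (e # es)"
  shows "P vs es"
  using assms(1)
proof (induction es arbitrary: vs)
  case Nil
  then obtain a where "vs = [a]" by (auto simp: path_in_def length_Suc_conv)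
  then show ?case using assms(2) by simp
next
  case (Cons e es)
  then obtain a ws where vs: "vs = a # ws" by (cases vs) (auto simp: path_in_def)
  show ?case
    unfolding vs
    by (rule assms(3)) (use path_in_ConsE[of G a ws e es] Cons vs in auto)
qed

lemma path_ends_subset:
  assumes "path_in G vs es" "e \<in> set es"
  shows "ends G e \<subseteq> set vs"
  using assms by (induction rule: path_in_induct) auto

lemma path_odd_deg:
  assumes "path_in G vs es"
  shows "odd (deg (ends G) (set es) v) \<longleftrightarrow> hd vs \<noteq> last vs \<and> v \<in> {hd vs, last vs}"
  using assms
proof (induction rule: path_in_induct)
  case (Nil a)
  then show ?case by (simp add: deg_def)
next
  case (Cons a vs e es)
  have "e \<notin> set es" using path_ends_subset[OF Cons.hyps(1), of e] Cons.hyps by auto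
  then have d: "deg (ends G) (set (e # es)) v = deg (ends G) {e} v + deg (ends G) (set es) v"
    using deg_Un[of "{e}" "set es" "ends G" v] by simp
  have "{f \<in> {e}. v \<in> ends G f} = (if v \<in> {a, hd vs} then {e} else {})"
    using Cons.hyps by auto
  then have o: "odd (deg (ends G) {e} v) \<longleftrightarrow> v \<in> {a, hd vs}" by (simp add: deg_def)
  have "odd (deg (ends G) (set (e # es)) v) \<longleftrightarrow>
      (v \<in> {a, hd vs}) \<noteq> (hd vs \<noteq> last vs \<and> v \<in> {hd vs, last vs})"
    by (simp only: d odd_add o Cons.IH)
  moreover have "a \<noteq> hd vs" "a \<noteq> last vs" "last (a # vs) = last vs" using Cons.hyps by auto
  ultimately show ?case
    by (cases "v = a"; cases "v = hd vs"; cases "v = last vs"; simp)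
qed

lemma path_reach:
  assumes "path_in G vs es" "v \<in> set vs"
  shows "v \<in> reach (ends G) (set es) (hd vs)"
  using assms
proof (induction rule: path_in_induct)
  case (Cons a vs e es)
  show ?case
  proof (cases "v = a")
    case False
    then have "v \<in> reach (ends G) (set es) (hd vs)" using Cons by simp
    then have "v \<in> reach (ends G) (set (e # es)) (hd vs)" by (rule reach_mono[rotated]) auto
    moreover have "hd vs \<in> reach (ends G) (set (e # es)) a"
      using Cons.hyps by (intro reach_edge[of e]) auto
    ultimately show ?thesis by (simp add: reach_trans)
  qed simp
qed simp

lemma path_incident:
  assumes "path_in G vs es" "es \<noteq> []" "v \<in> set vs"
  shows "\<exists>e\<in>set es. v \<in> ends G e"
  using assms
proof (induction rule: path_in_induct)
  case (Cons a vs e es)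
  show ?case
  proof (cases "es = []")
    case True
    then have "length vs = 1" using Cons.hyps(1) by (simp add: path_in_def)
    then obtain b where "vs = [b]" by (auto simp: length_Suc_conv)
    then show ?thesis using Cons by auto
  qed (use Cons in auto)
qed simp

lemma three_edge_colors_at_vertex:
  assumes "cubic K" "proper_edge_coloring 3 K col" "v \<in> verts K" "t < 3"
  shows "deg (ends K) {f \<in> edges K. col f \<noteq> t} v = 2"
proof -
  let ?A = "{f \<in> edges K. v \<in> ends K f}"
  have c3: "card ?A = 3" using assms(1,3) by (simp add: cubic_def regular_def degree_def)
  then have fin: "finite ?A" by (metis card.infinite zero_neq_numeral)
  have inj: "inj_on col ?A" using assms(2) by (auto simp: inj_on_def proper_edge_coloring_def)
  have "col ` ?A \<subseteq> {..<3}" using assms(2) by (auto simp: proper_edge_coloring_def)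
  moreover have "card (col ` ?A) = 3" using c3 card_image[OF inj] by simp
  ultimately have img: "col ` ?A = {..<3}" by (intro card_subset_eq) auto
  have "card {f \<in> ?A. col f \<noteq> t} = card (col ` {f \<in> ?A. col f \<noteq> t})"
    using inj by (intro card_image[symmetric]) (auto simp: inj_on_def)
  also have "col ` {f \<in> ?A. col f \<noteq> t} = {..<3} - {t}" using img by auto
  also have "card ({..<3} - {t}) = 2" using assms(4) by simp
  also have "{f \<in> ?A. col f \<noteq> t} = {f \<in> {f \<in> edges K. col f \<noteq> t}. v \<in> ends K f}" by auto
  finally show ?thesis by (simp only: deg_def)
qed

text \<open>The two colours form a 2-regular graph on all vertices. Each of its components is a
  cycle with at most two colours and therefore hamiltonian.\<close>

lemma kotzig_two_colors_connected:
  assumes K: "cubic K" "proper_edge_coloring 3 K col"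
    and ham: "\<And>C. cycle_of C K \<Longrightarrow> card (col ` edges C) \<le> 2 \<Longrightarrow> hamiltonian_cycle_of C K"
    and "u \<in> verts K" "v \<in> verts K" "t < 3"
  shows "v \<in> reach (ends K) {f \<in> edges K. col f \<noteq> t} u"
proof -
  let ?X = "{f \<in> edges K. col f \<noteq> t}"
  let ?C = "class_graph (ends K) ?X u"
  have d2: "deg (ends K) ?X w = 2" if "w \<in> verts K" for w
    using three_edge_colors_at_vertex[OF K that assms(6)] .
  have "{f \<in> ?X. u \<in> ends K f} \<noteq> {}"
    using d2[OF assms(4)] unfolding deg_def by (metis card.empty zero_neq_numeral)
  then obtain f where f: "f \<in> ?X" "u \<in> ends K f" by blast
  have "cycle_of ?C K"
    by (rule cycle_class_graph[OF K(1) _ _ f]) (use d2 in auto)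
  moreover have "col ` edges ?C \<subseteq> {..<3} - {t}"
    using K(2) by (auto simp: class_graph_def proper_edge_coloring_def)
  then have "card (col ` edges ?C) \<le> card ({..<3} - {t})" by (intro card_mono) auto
  then have "card (col ` edges ?C) \<le> 2" using assms(6) by simp
  ultimately have "verts ?C = verts K" using ham by (auto simp: hamiltonian_cycle_of_def)
  then show ?thesis using assms(5) by (simp add: class_graph_def)
qed

text \<open>Every edge of a path inherits the colour of the edge of \<open>K\<close> that the path replaces. A path has odd
  degree precisely at its two ends, so parities in \<open>H\<close> are those in \<open>K\<close>, and connections in \<open>K\<close> are
  carried over along the paths.\<close>

lemma kotzig_part_of_subdivision:
  assumes "kotzig_subdivision H"
  shows "\<exists>c. kotzig_part (ends H) (edges H) (verts H) c"
proof -
  obtain K :: "('a, 'b) mgraph" where K: "kotzig_graph K" "subdivision H K"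
    using assms by (auto simp: kotzig_subdivision_def)
  obtain col where cub: "cubic K" and col: "proper_edge_coloring 3 K col"
    and ham: "\<And>C. cycle_of C K \<Longrightarrow> card (col ` edges C) \<le> 2 \<Longrightarrow> hamiltonian_cycle_of C K"
    using K(1) unfolding kotzig_graph_def by blast
  have mH: "multigraph H" and mK: "multigraph K" using K(2) by (auto simp: subdivision_def)
  obtain P Q where path: "\<And>f. f \<in> edges K \<Longrightarrow> path_in H (P f) (Q f)"
    and ends_P: "\<And>f. f \<in> edges K \<Longrightarrow> ends K f = {hd (P f), last (P f)}"
    and disjQ: "\<And>f g. f \<in> edges K \<Longrightarrow> g \<in> edges K \<Longrightarrow> f \<noteq> g \<Longrightarrow> set (Q f) \<inter> set (Q g) = {}"
    and vH: "verts H = verts K \<union> (\<Union>f\<in>edges K. set (P f))"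
    and eH: "edges H = (\<Union>f\<in>edges K. set (Q f))"
    using K(2) unfolding subdivision_def by (elim conjE exE) (rule that; (assumption | simp))
  define c where "c e = col (SOME f. f \<in> edges K \<and> e \<in> set (Q f))" for e
  have c: "c e = col f" if "f \<in> edges K" "e \<in> set (Q f)" for e f
  proof -
    have "(SOME f. f \<in> edges K \<and> e \<in> set (Q f)) = f"
    proof (rule some_equality)
      fix g assume "g \<in> edges K \<and> e \<in> set (Q g)"
      then show "g = f" using disjQ[of f g] that by blast
    qed (use that in simp)
    then show ?thesis by (simp add: c_def)
  qed
  have c2K: "card (ends K f) = 2" if "f \<in> edges K" for f using mK that by (simp add: multigraph_def)
  have P_ne: "P f \<noteq> []" "hd (P f) \<noteq> last (P f)" "Q f \<noteq> []" if "f \<in> edges K" for f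
  proof -
    have l: "length (P f) = Suc (length (Q f))" using path[OF that] by (simp add: path_in_def)
    then show "P f \<noteq> []" by auto
    show ne: "hd (P f) \<noteq> last (P f)" using c2K[OF that] ends_P[OF that] by auto
    show "Q f \<noteq> []"
    proof
      assume "Q f = []"
      then have "length (P f) = 1" using l by simp
      then show False using ne by (auto simp: length_Suc_conv)
    qed
  qed
  define Kt where "Kt t = {f \<in> edges K. col f \<noteq> t}" for t
  define R where "R t = {e \<in> edges H. ends H e \<subseteq> verts H \<and> c e \<noteq> t}" for t
  have endsH: "ends H e \<subseteq> verts H" if "e \<in> edges H" for e using mH that by (simp add: multigraph_def)
  have R_eq: "R t = (\<Union>f\<in>Kt t. set (Q f))" for t
    using c endsH unfolding R_def Kt_def eH by auto
  have finK: "finite (Kt t)" for t using mK by (simp add: Kt_def multigraph_def)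
  have even: "even (deg (ends H) (R t) v)" if "t < 3" for t v
  proof -
    have "{e \<in> R t. v \<in> ends H e} = (\<Union>f\<in>Kt t. {e \<in> set (Q f). v \<in> ends H e})" by (auto simp: R_eq)
    moreover have "card (\<Union>f\<in>Kt t. {e \<in> set (Q f). v \<in> ends H e}) = (\<Sum>f\<in>Kt t. deg (ends H) (set (Q f)) v)"
      unfolding deg_def using finK disjQ by (intro card_UN_disjoint) (auto simp: Kt_def)
    ultimately have "odd (deg (ends H) (R t) v) \<longleftrightarrow> odd (card {f \<in> Kt t. odd (deg (ends H) (set (Q f)) v)})"
      using odd_sum_card[OF finK, of "\<lambda>f. deg (ends H) (set (Q f)) v" t] by (simp add: deg_def)
    also have "{f \<in> Kt t. odd (deg (ends H) (set (Q f)) v)} = {f \<in> Kt t. v \<in> ends K f}"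
    proof (rule Collect_cong, rule conj_cong[OF refl])
      fix f assume "f \<in> Kt t"
      then have "f \<in> edges K" by (simp add: Kt_def)
      then show "odd (deg (ends H) (set (Q f)) v) \<longleftrightarrow> v \<in> ends K f"
        using path_odd_deg[OF path, of f v] P_ne(2)[of f] ends_P[of f] by simp
    qed
    finally have eq: "odd (deg (ends H) (R t) v) \<longleftrightarrow> odd (card {f \<in> Kt t. v \<in> ends K f})" .
    have "even (card {f \<in> Kt t. v \<in> ends K f})"
    proof (cases "v \<in> verts K")
      case True
      then show ?thesis
        using three_edge_colors_at_vertex[OF cub col True that] by (simp add: deg_def Kt_def)
    next
      case False
      then have "{f \<in> Kt t. v \<in> ends K f} = {}" using mK by (auto simp: Kt_def multigraph_def)
      then show ?thesis by (simp only: card.empty even_zero)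
    qed
    then show ?thesis using eq by blast
  qed
  have along: "x \<in> reach (ends H) (R t) (hd (P f))" if "f \<in> Kt t" "x \<in> set (P f)" for f t x
  proof -
    have "f \<in> edges K" using that by (simp add: Kt_def)
    then have "x \<in> reach (ends H) (set (Q f)) (hd (P f))" using path_reach[OF path] that by blast
    then show ?thesis by (rule reach_mono[rotated]) (use that R_eq in auto)
  qed
  have conn: "v \<in> reach (ends H) (R t) u"
    if t: "t < 3" and e: "e \<in> R t" "u \<in> ends H e" and f: "f \<in> R t" "v \<in> ends H f" for t e f u v
  proof -
    obtain a where a: "a \<in> Kt t" "e \<in> set (Q a)" using e R_eq by auto
    obtain b where b: "b \<in> Kt t" "f \<in> set (Q b)" using f R_eq by auto
    have aK: "a \<in> edges K" "b \<in> edges K" using a b by (auto simp: Kt_def)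
    have "u \<in> set (P a)" "v \<in> set (P b)"
      using path_ends_subset[OF path] a b e f aK by blast+
    then have u: "u \<in> reach (ends H) (R t) (hd (P a))" and v: "v \<in> reach (ends H) (R t) (hd (P b))"
      using along a b by auto
    have hK: "hd (P a) \<in> verts K" "hd (P b) \<in> verts K"
      using ends_P aK mK by (auto simp: multigraph_def)
    have "reach (ends K) (Kt t) (hd (P a)) \<subseteq> reach (ends H) (R t) (hd (P a))"
    proof (rule reach_subset)
      fix g assume g: "g \<in> Kt t" "ends K g \<inter> reach (ends H) (R t) (hd (P a)) \<noteq> {}"
      then have gK: "g \<in> edges K" by (simp add: Kt_def)
      have on_P: "ends K g \<subseteq> set (P g)" using ends_P[OF gK] P_ne(1)[OF gK] by auto
      obtain x where x: "x \<in> ends K g" "x \<in> reach (ends H) (R t) (hd (P a))" using g by auto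
      have "x \<in> reach (ends H) (R t) (hd (P g))" using along[OF g(1)] x on_P by auto
      then have g_a: "hd (P g) \<in> reach (ends H) (R t) (hd (P a))"
        using reach_trans[OF x(2) reach_sym] by blast
      then show "ends K g \<subseteq> reach (ends H) (R t) (hd (P a))"
        using reach_trans[OF g_a along[OF g(1)]] on_P by blast
    qed simp
    moreover have "hd (P b) \<in> reach (ends K) (Kt t) (hd (P a))"
      using kotzig_two_colors_connected[OF cub col ham hK t] by (simp add: Kt_def)
    ultimately have "hd (P b) \<in> reach (ends H) (R t) (hd (P a))" by blast
    then show ?thesis using reach_trans[OF reach_sym[OF u] reach_trans[OF _ v]] by blast
  qed
  have inc: "\<exists>e\<in>edges H. v \<in> ends H e \<and> ends H e \<subseteq> verts H" if v: "v \<in> verts H" for v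
  proof -
    have "\<exists>f\<in>edges K. v \<in> set (P f)"
    proof (cases "v \<in> verts K")
      case True
      have "{f \<in> {f \<in> edges K. col f \<noteq> 0}. v \<in> ends K f} \<noteq> {}"
        using three_edge_colors_at_vertex[OF cub col True, of 0] unfolding deg_def
        by (metis card.empty zero_neq_numeral zero_less_numeral)
      then obtain f where f: "f \<in> edges K" "v \<in> ends K f" by auto
      then have "v \<in> set (P f)" using ends_P[OF f(1)] P_ne(1)[OF f(1)] by auto
      then show ?thesis using f by blast
    qed (use v vH in auto)
    then obtain f where f: "f \<in> edges K" "v \<in> set (P f)" by blast
    obtain e where "e \<in> set (Q f)" "v \<in> ends H e"
      using path_incident[OF path[OF f(1)] P_ne(3)[OF f(1)] f(2)] by blast
    then show ?thesis using f eH endsH by blast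
  qed
  have lt: "c e < 3" if "e \<in> edges H" for e
    using that c col unfolding eH by (auto simp: proper_edge_coloring_def)
  have "kotzig_part (ends H) (edges H) (verts H) c"
    unfolding kotzig_part_def R_def[symmetric] using lt inc even conn by blast
  then show ?thesis by blast
qed

section \<open>The components of a frame\<close>

lemma component_class_graph:
  assumes "multigraph F" "v \<in> verts F"
  shows "component (class_graph (ends F) (edges F) v) F"
  unfolding component_def
proof (intro conjI allI impI)
  show "subgraph (class_graph (ends F) (edges F) v) F" using assms by (intro subgraph_class_graph) auto
  show "connected (class_graph (ends F) (edges F) v)" by (rule class_graph_connected)
  fix D assume D: "subgraph D F \<and> connected D \<and> subgraph (class_graph (ends F) (edges F) v) D"
  have DF: "verts D \<subseteq> verts F" "edges D \<subseteq> edges F" "ends D = ends F" "multigraph D"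
    using D by (auto simp: subgraph_def)
  have "subgraph (class_graph (ends F) (edges F) v) D" using D by blast
  then have "verts (class_graph (ends F) (edges F) v) \<subseteq> verts D"
    "edges (class_graph (ends F) (edges F) v) \<subseteq> edges D"
    unfolding subgraph_def by blast+
  then have sub: "reach (ends F) (edges F) v \<subseteq> verts D"
    "{e \<in> edges F. ends F e \<subseteq> reach (ends F) (edges F) v} \<subseteq> edges D"
    by (simp_all only: class_graph_def mgraph.select_convs)
  then have vD: "v \<in> verts D" using reach_refl by fast
  have "u \<in> reach (ends F) (edges F) v" if "u \<in> verts D" for u
  proof -
    have "u \<in> reach (ends F) (edges D) v"
      using D vD that DF(3) by (auto simp: connected_def adjacency_eq_link reach_def)
    then show ?thesis by (rule reach_mono[OF DF(2)])
  qed
  then have V: "verts D = reach (ends F) (edges F) v" using sub(1) by blast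
  have "ends F e \<subseteq> verts D" if "e \<in> edges D" for e
    using DF that by (auto simp: multigraph_def)
  then have "edges D = {e \<in> edges F. ends F e \<subseteq> reach (ends F) (edges F) v}"
    using sub(2) DF(2) V by blast
  then show "D = class_graph (ends F) (edges F) v"
    using V DF(3) by (simp add: class_graph_def)
qed

text \<open>A component is compared with the class of one of its vertices. It follows that a finite graph has
  finitely many components.\<close>

lemma component_is_class_graph:
  assumes "multigraph F" "component C F"
  shows "\<exists>v\<in>verts F. C = class_graph (ends F) (edges F) v"
proof -
  have C: "subgraph C F" "connected C" using assms(2) by (auto simp: component_def)
  then obtain v where v: "v \<in> verts C" by (auto simp: connected_def)
  then have vF: "v \<in> verts F" using C(1) by (auto simp: subgraph_def)
  let ?D = "class_graph (ends F) (edges F) v"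
  have D: "component ?D F" using assms(1) vF by (rule component_class_graph)
  have CF: "verts C \<subseteq> verts F" "edges C \<subseteq> edges F" "ends C = ends F" "multigraph C"
    using C(1) by (auto simp: subgraph_def)
  have "u \<in> reach (ends F) (edges F) v" if "u \<in> verts C" for u
  proof -
    have "u \<in> reach (ends F) (edges C) v"
      using C(2) v that CF(3) by (auto simp: connected_def adjacency_eq_link reach_def)
    then show ?thesis by (rule reach_mono[OF CF(2)])
  qed
  then have V: "verts C \<subseteq> reach (ends F) (edges F) v" by blast
  have "ends F e \<subseteq> verts C" if "e \<in> edges C" for e
    using CF that by (auto simp: multigraph_def)
  then have "edges C \<subseteq> {e \<in> edges F. ends F e \<subseteq> reach (ends F) (edges F) v}"
    using CF(2) V by blast
  then have "subgraph C ?D"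
    using CF(3,4) V by (simp add: subgraph_def class_graph_def)
  moreover have "subgraph ?D F" "connected ?D" using D by (auto simp: component_def)
  ultimately have "?D = C" using assms(2) by (simp add: component_def)
  then show ?thesis using vF by blast
qed

text \<open>An edge at \<open>v\<close> lies in an even set formed by two of the colours.\<close>

lemma kotzig_part_deg_ge_2:
  assumes "kotzig_part en B A c" "finite B" "v \<in> A"
  shows "deg en B v \<ge> 2"
proof -
  obtain e where e: "e \<in> B" "v \<in> en e" "en e \<subseteq> A" using assms by (auto simp: kotzig_part_def)
  obtain t where t: "t < 3" "t \<noteq> c e" using avoid_two by blast
  let ?R = "{e \<in> B. en e \<subseteq> A \<and> c e \<noteq> t}"
  have "e \<in> {f \<in> ?R. v \<in> en f}" using e t by auto
  then have "deg en ?R v \<noteq> 0" using assms(2) by (auto simp: deg_def)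
  moreover have "even (deg en ?R v)" using assms(1) t(1) by (simp add: kotzig_part_def)
  moreover have "deg en ?R v \<le> deg en B v"
    unfolding deg_def using assms(2) by (intro card_mono) auto
  moreover have "2 \<le> n" if "n \<noteq> 0" "even n" for n :: nat using that by presburger
  ultimately show ?thesis by (meson le_trans)
qed

lemma kotzig_part_empty: "\<forall>e\<in>B. card (en e) = 2 \<Longrightarrow> kotzig_part en B {} c"
proof -
  assume c: "\<forall>e\<in>B. card (en e) = 2"
  have ne: "en e \<noteq> {}" if "e \<in> B" for e using c that by force
  have none: "card {e \<in> B. en e = {} \<and> P e} = 0" for P
  proof -
    have "{e \<in> B. en e = {} \<and> P e} = {}" using ne by blast
    then show ?thesis by (simp only: card.empty)
  qed
  show ?thesis using ne by (simp add: kotzig_part_def deg_def none)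
qed

lemma at_most_two:
  assumes "finite S" "card S \<le> 2"
  shows "S = {} \<or> (\<exists>x. S = {x}) \<or> (\<exists>x y. x \<noteq> y \<and> S = {x, y})"
proof -
  have "card S = 0 \<or> card S = 1 \<or> card S = 2" using assms(2) by auto
  then show ?thesis using assms(1) by (auto simp: card_1_singleton_iff card_2_iff)
qed

theorem corollary7:
  fixes G F :: "('v, 'e) mgraph"
  assumes "two_connected G" and "cubic G"
    and "kotzig_frame F G"
    and "card {C. K_component C F} \<le> 2"
  shows "\<exists>S. k_cycle_double_cover 6 S G"
proof -
  define V E B en where "V = verts G" and "E = edges G" and "B = edges F" and "en = ends G"
  define H where "H = class_graph en B"
  have mG: "multigraph G" and deg3: "\<And>v. v \<in> V \<Longrightarrow> deg en E v = 3"
    using assms(2) by (auto simp: cubic_def regular_def V_def E_def en_def degree_eq_deg)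
  have F: "multigraph F" "verts F = V" "B \<subseteq> E" "ends F = en"
    using assms(3) by (auto simp: kotzig_frame_def spanning_subgraph_def subgraph_def V_def E_def B_def en_def)
  have fin: "finite V" "finite E" "finite B"
    using mG F by (auto simp: multigraph_def V_def E_def B_def)
  have en: "en e \<subseteq> V" "card (en e) = 2" if "e \<in> E" for e
    using mG that by (auto simp: multigraph_def V_def E_def en_def)
  have c2: "\<forall>e\<in>B. card (en e) = 2" using en F(3) by auto
  have comp: "component (H v) F" if "v \<in> V" for v
    using component_class_graph[OF F(1)] that F by (simp add: H_def B_def)
  have even_H: "even (card (reach en B v))" and CK: "cycle (H v) \<or> K_component (H v) F" if "v \<in> V" for v
    using assms(3) comp[OF that] by (auto simp: kotzig_frame_def C_component_def H_def class_graph_def)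
  have closed_class: "en e \<subseteq> reach en B v" if "e \<in> B" "x \<in> en e" "x \<in> reach en B v" for e x v
    using reach_ends_subset[OF c2 that] .
  have deg_cycle: "deg en B v = 2" if "v \<in> V" "cycle (H v)" for v
  proof -
    have "degree (H v) v = 2" using that(2) by (simp add: cycle_def regular_def H_def class_graph_def)
    then show ?thesis
      using class_graph_edges_at[OF c2 reach_refl] by (simp add: H_def degree_def deg_def class_graph_def)
  qed
  define KV where "KV A \<longleftrightarrow> A = {} \<or> (\<exists>v\<in>V. A = reach en B v \<and> K_component (H v) F)" for A
  have kp: "\<exists>c. kotzig_part en B A c" if "KV A" for A
  proof (cases "A = {}")
    case True
    then show ?thesis using kotzig_part_empty[OF c2] by blast
  next
    case False
    then obtain v where v: "v \<in> V" "A = reach en B v" "K_component (H v) F" using \<open>KV A\<close> by (auto simp: KV_def)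
    obtain c where "kotzig_part (ends (H v)) (edges (H v)) (verts (H v)) c"
      using kotzig_part_of_subdivision v(3) by (auto simp: K_component_def)
    then have "kotzig_part en {e \<in> B. en e \<subseteq> A} A c" using v(2) by (simp add: H_def class_graph_def)
    moreover have "{e \<in> {e \<in> B. en e \<subseteq> A}. en e \<subseteq> A \<and> P e} = {e \<in> B. en e \<subseteq> A \<and> P e}" for P by auto
    ultimately have "kotzig_part en B A c" by (simp add: kotzig_part_def) blast
    then show ?thesis by blast
  qed
  have KV_sub: "A \<subseteq> V" and KV_closed: "\<And>e x. e \<in> B \<Longrightarrow> x \<in> en e \<Longrightarrow> x \<in> A \<Longrightarrow> en e \<subseteq> A"
    and KV_even: "even (card A)" if "KV A" for A
  proof -
    have V: "reach en B v \<subseteq> V" if "v \<in> V" for v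
      using that en F(3) by (intro reach_subset) blast+
    show "A \<subseteq> V" using that V by (auto simp: KV_def)
    show "even (card A)" using that even_H by (auto simp: KV_def)
    show "en e \<subseteq> A" if "e \<in> B" "x \<in> en e" "x \<in> A" for e x
      using \<open>KV A\<close> closed_class[OF that(1,2)] that(3) by (auto simp: KV_def)
  qed
  obtain A A' where A: "KV A" "KV A'" "A \<inter> A' = {}"
    and cov: "\<And>v. v \<in> V \<Longrightarrow> K_component (H v) F \<Longrightarrow> v \<in> A \<or> v \<in> A'"
  proof -
    let ?K = "{C. K_component C F}"
    have sub: "\<exists>v\<in>V. C = H v" if "C \<in> ?K" for C
      using component_is_class_graph[OF F(1)] that F by (auto simp: K_component_def H_def B_def)
    then have "?K \<subseteq> H ` V" by blast
    then have "finite ?K" using fin(1) finite_subset by blast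
    then consider "?K = {}" | C where "?K = {C}" | C D where "C \<noteq> D" "?K = {C, D}"
      using at_most_two[OF _ assms(4)] by blast
    then show ?thesis
    proof cases
      case 1
      then show ?thesis using that[of "{}" "{}"] by (auto simp: KV_def)
    next
      case (2 C)
      then obtain u where u: "u \<in> V" "C = H u" using sub by blast
      have "K_component (H u) F" using 2 u by blast
      then have "KV (reach en B u)" using u by (auto simp: KV_def)
      moreover have "v \<in> reach en B u" if "v \<in> V" "K_component (H v) F" for v
      proof -
        have "H v = H u" using 2 that u by blast
        then show ?thesis using reach_refl[of v en B] by (simp add: H_def class_graph_def)
      qed
      ultimately show ?thesis using that[of "reach en B u" "{}"] by (auto simp: KV_def)
    next
      case (3 C D)
      then obtain u w where u: "u \<in> V" "C = H u" and w: "w \<in> V" "D = H w" using sub by blast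
      have "K_component (H u) F" "K_component (H w) F" using 3 u w by blast+
      then have "KV (reach en B u)" "KV (reach en B w)" using u w by (auto simp: KV_def)
      moreover have "reach en B u \<inter> reach en B w = {}"
      proof (rule ccontr)
        assume "reach en B u \<inter> reach en B w \<noteq> {}"
        then obtain x where "x \<in> reach en B u" "x \<in> reach en B w" by blast
        then have "reach en B u = reach en B w" using reach_eq[of x en B] by metis
        then show False using 3(1) u w by (simp add: H_def class_graph_def)
      qed
      moreover have "v \<in> reach en B u \<or> v \<in> reach en B w" if "v \<in> V" "K_component (H v) F" for v
      proof -
        have "H v = H u \<or> H v = H w" using 3 that u w by blast
        then show ?thesis using reach_refl[of v en B] by (auto simp: H_def class_graph_def)
      qed
      ultimately show ?thesis using that[of "reach en B u" "reach en B w"] by blast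
    qed
  qed
  obtain c where c: "kotzig_part en B A c" using kp[OF A(1)] by blast
  obtain c' where c': "kotzig_part en B A' c'" using kp[OF A(2)] by blast
  have cyc: "deg en B v = 2" if "v \<in> V" "v \<notin> A" "v \<notin> A'" for v
    using deg_cycle CK cov that by blast
  have ge2: "deg en B v \<ge> 2" if "v \<in> V" for v
    using cyc[OF that] kotzig_part_deg_ge_2[OF c fin(3)] kotzig_part_deg_ge_2[OF c' fin(3)] by fastforce
  have split: "deg en (E - B) v + deg en B v = 3" if "v \<in> V" for v
    using deg_Diff[OF fin(2) F(3)] deg3[OF that] by metis
  interpret framed_graph en V E B A A' c c'
  proof
    show "\<And>v. v \<in> V \<Longrightarrow> deg en (E - B) v \<le> 1" using split ge2 by fastforce
    show "\<And>v. v \<in> V - A - A' \<Longrightarrow> deg en (E - B) v = 1 \<and> deg en B v = 2" using split cyc by fastforce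
    show "even (card (reach en B v))" if "v \<in> V - A - A'" for v using even_H that by blast
    show "en e \<subseteq> A \<or> en e \<subseteq> A' \<or> en e \<subseteq> V - A - A'" if "e \<in> B" for e
      using KV_closed[OF A(1) that] KV_closed[OF A(2) that] en(1)[of e] F(3) that by blast
    have finA: "finite A" using KV_sub[OF A(1)] fin(1) finite_subset by blast
    have "even (\<Sum>v\<in>A. deg en B v)"
      using c2 KV_closed[OF A(1)] by (intro even_sum_deg fin(3) finA) auto
    then have "even (card {v \<in> A. odd (deg en B v)})" using odd_sum_card[OF finA] by blast
    moreover have "{v \<in> A. deg en (E - B) v = 1} = A - {v \<in> A. odd (deg en B v)}"
    proof -
      have "deg en (E - B) v = 1 \<longleftrightarrow> even (deg en B v)" if "v \<in> A" for v
      proof -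
        have "v \<in> V" using that KV_sub[OF A(1)] by blast
        then have "deg en B v = 2 \<or> deg en B v = 3" "deg en (E - B) v + deg en B v = 3"
          using split ge2 by fastforce+
        then show ?thesis by auto
      qed
      then show ?thesis by blast
    qed
    moreover have "card (A - {v \<in> A. odd (deg en B v)}) = card A - card {v \<in> A. odd (deg en B v)}"
      using finA by (intro card_Diff_subset) auto
    ultimately show "even (card {v \<in> A. deg en (E - B) v = 1})" using KV_even[OF A(1)] by simp
  qed (use fin F en A c c' KV_sub in auto)
  obtain X where X: "\<And>i. i < 6 \<Longrightarrow> X i \<subseteq> E \<and> (\<forall>v. even (deg en (X i) v))"
    "\<And>e. e \<in> E \<Longrightarrow> card {i. i < (6::nat) \<and> e \<in> X i} = 2"
    using six_even_sets_of_frame by blast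
  show ?thesis
    by (rule even_sets_double_cover[OF assms(2), of 6 X]) (use X in \<open>auto simp: E_def en_def\<close>)
qed

end
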